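(* Let $k\geq 1$ and let $K^{-1}(P_k)$ denote the unique (up to isomorphism) graph $H\in\mathcal{T}$ whose clique graph $K(H)$ is isomorphic to the path $P_k$. If $G\in\mathcal{T}$ has the same adjacency spectrum (with multiplicities) as $K^{-1}(P_k)$, then $G$ is isomorphic to $K^{-1}(P_k)$.
   Context: Graphs are finite, simple and undirected. $T$ denotes the triangle $K_3$ and $P_k$ the path on $k$ vertices. The set $\mathcal{T}$ is defined recursively: $T\in\mathcal{T}$, and if $H\in\mathcal{T}$, then the graph obtained by identifying a vertex of degree $2$ of $H$ with a vertex of a new (disjoint) copy of $T$ belongs to $\mathcal{T}$. The clique graph $K(G)$ has as vertices the maximal complete subgraphs of $G$, two of them adjacent iff they share at least one vertex. *)

theory Defs
  imports
    "Graph_Theory.Graph_Theory"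
    "Jordan_Normal_Form.Spectral_Radius"
begin

text \<open>
  As in \<^theory>\<open>Graph_Theory.Digraph\<close>, an undirected graph is a symmetric digraph: each edge
  is a pair of opposite arcs, so the degree of a vertex is its out-degree. The new triangle is taken
  on a vertex set meeting that of \<open>H\<close> in exactly \<open>v\<close>; the union is then the graph
  obtained by identifying \<open>v\<close> with a vertex of a disjoint triangle.
\<close>

inductive_set triangle_family :: "'a pair_pre_digraph set" where
  triangle: "K\<^bsub>3\<^esub> (with_proj D) \<Longrightarrow> D \<in> triangle_family"
| glue: "\<lbrakk>H \<in> triangle_family; v \<in> pverts H; out_degree (with_proj H) v = 2;
          K\<^bsub>3\<^esub> (with_proj D); pverts H \<inter> pverts D = {v}\<rbrakk>
    \<Longrightarrow> \<lparr>pverts = pverts H \<union> pverts D, parcs = parcs H \<union> parcs D\<rparr> \<in> triangle_family"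

definition is_clique :: "'a pair_pre_digraph \<Rightarrow> 'a set \<Rightarrow> bool" where
  "is_clique G Q \<longleftrightarrow> Q \<noteq> {} \<and> Q \<subseteq> pverts G \<and> (\<forall>u\<in>Q. \<forall>v\<in>Q. u \<noteq> v \<longrightarrow> (u, v) \<in> parcs G)"

definition max_cliques :: "'a pair_pre_digraph \<Rightarrow> 'a set set" where
  "max_cliques G = {Q. is_clique G Q \<and> (\<forall>R. is_clique G R \<and> Q \<subseteq> R \<longrightarrow> R = Q)}"

definition clique_graph :: "'a pair_pre_digraph \<Rightarrow> 'a set pair_pre_digraph" where
  "clique_graph G = \<lparr>pverts = max_cliques G,
     parcs = {(Q, R). Q \<in> max_cliques G \<and> R \<in> max_cliques G \<and> Q \<noteq> R \<and> Q \<inter> R \<noteq> {}}\<rparr>"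

definition path_graph :: "nat \<Rightarrow> nat pair_pre_digraph" where
  "path_graph k = \<lparr>pverts = {..<k}, parcs = {(i, j). i < k \<and> j < k \<and> (j = Suc i \<or> i = Suc j)}\<rparr>"

definition adj_matrix :: "'a pair_pre_digraph \<Rightarrow> 'a list \<Rightarrow> complex mat" where
  "adj_matrix G vs = mat (length vs) (length vs)
     (\<lambda>(i, j). if (vs ! i, vs ! j) \<in> parcs G then 1 else 0)"

text \<open>
  The eigenvalues with their algebraic multiplicities. They are taken in the complex numbers, so
  that the multiset has one entry for each vertex without appeal to the fact that a real symmetric
  matrix has only real eigenvalues. The choice of the enumeration is immaterial, see
  \<open>adj_spectrum_enum\<close>.
\<close>

definition adj_spectrum :: "'a pair_pre_digraph \<Rightarrow> complex multiset" where
  "adj_spectrum G =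
     proots (char_poly (adj_matrix G (SOME vs. distinct vs \<and> set vs = pverts G)))"

lemma adj_spectrum_enum:
  assumes vs: "distinct vs" "set vs = pverts G"
  shows "adj_spectrum G = proots (char_poly (adj_matrix G vs))"
proof -
  define ws where "ws = (SOME vs. distinct vs \<and> set vs = pverts G)"
  have ws: "distinct ws" "set ws = pverts G"
    unfolding ws_def using someI[of "\<lambda>vs. distinct vs \<and> set vs = pverts G" vs] vs by auto
  let ?n = "length vs"
  have len: "length ws = ?n"
    using vs ws by (metis distinct_card)
  define perm :: "'a list \<Rightarrow> 'a list \<Rightarrow> complex mat" where
    "perm xs ys = mat ?n ?n (\<lambda>(i, j). if xs ! i = ys ! j then 1 else 0)" for xs ys
  have perm_idx: "perm xs ys $$ (i, j) = (if xs ! i = ys ! j then 1 else 0)"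
    if "i < ?n" "j < ?n" for xs ys i j
    using that by (simp add: perm_def)
  have dims: "perm xs ys \<in> carrier_mat ?n ?n" for xs ys
    by (simp add: perm_def)
  have sum_enum: "(\<Sum>l = 0..<?n. f (xs ! l)) = sum f (pverts G)"
    if "distinct xs" "set xs = pverts G" "length xs = ?n" for xs and f :: "'a \<Rightarrow> complex"
    using sum.reindex_bij_betw[OF bij_betw_nth[OF that(1) refl refl], of f] that
    by (simp add: atLeast0LessThan)
  have fin: "finite (pverts G)"
    using vs by (metis List.finite_set)
  have nthG: "xs ! i \<in> pverts G" if "set xs = pverts G" "length xs = ?n" "i < ?n" for xs i
    using that nth_mem by metis
  have inv: "perm xs ys * perm ys xs = 1\<^sub>m ?n"
    if xs: "distinct xs" "set xs = pverts G" "length xs = ?n"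
      and ys: "distinct ys" "set ys = pverts G" "length ys = ?n" for xs ys
  proof (rule eq_matI)
    fix i j assume ij: "i < dim_row (1\<^sub>m ?n :: complex mat)" "j < dim_col (1\<^sub>m ?n :: complex mat)"
    then have "(perm xs ys * perm ys xs) $$ (i, j) =
        (\<Sum>l = 0..<?n. (\<lambda>y. (if xs ! i = y then 1 else 0) * (if y = xs ! j then 1 else 0)) (ys ! l))"
      by (simp add: perm_def scalar_prod_def)
    also have "\<dots> = (\<Sum>y\<in>pverts G. (if xs ! i = y then 1 else 0) * (if y = xs ! j then 1 else 0))"
      by (rule sum_enum[OF ys])
    also have "\<dots> = (\<Sum>y\<in>pverts G. if xs ! i = y then (if y = xs ! j then 1 else 0) else 0)"
      by (rule sum.cong) auto
    also have "\<dots> = 1\<^sub>m ?n $$ (i, j)"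
      using ij fin nthG[OF xs(2,3), of i] xs by (simp add: nth_eq_iff_index_eq)
    finally show "(perm xs ys * perm ys xs) $$ (i, j) = 1\<^sub>m ?n $$ (i, j)" .
  qed (simp_all add: perm_def)
  have conj: "perm ws vs * adj_matrix G vs * perm vs ws = adj_matrix G ws"
  proof (rule eq_matI)
    let ?a = "\<lambda>u v. if (u, v) \<in> parcs G then 1 else (0 :: complex)"
    have left: "(perm ws vs * adj_matrix G vs) $$ (i, l) = ?a (ws ! i) (vs ! l)"
      if "i < ?n" "l < ?n" for i l
    proof -
      have "(perm ws vs * adj_matrix G vs) $$ (i, l) =
          (\<Sum>m = 0..<?n. (\<lambda>y. (if ws ! i = y then 1 else 0) * ?a y (vs ! l)) (vs ! m))"
        using that by (simp add: perm_def adj_matrix_def scalar_prod_def)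
      also have "\<dots> = (\<Sum>y\<in>pverts G. (if ws ! i = y then 1 else 0) * ?a y (vs ! l))"
        by (rule sum_enum) (use vs in auto)
      also have "\<dots> = (\<Sum>y\<in>pverts G. if ws ! i = y then ?a y (vs ! l) else 0)"
        by (rule sum.cong) auto
      also have "\<dots> = ?a (ws ! i) (vs ! l)"
        using that fin nthG[OF ws(2) len, of i] by simp
      finally show ?thesis .
    qed
    fix i j assume "i < dim_row (adj_matrix G ws)" "j < dim_col (adj_matrix G ws)"
    then have ij: "i < ?n" "j < ?n"
      by (simp_all add: adj_matrix_def len)
    have "(perm ws vs * adj_matrix G vs * perm vs ws) $$ (i, j) =
        (\<Sum>l = 0..<?n. (perm ws vs * adj_matrix G vs) $$ (i, l) * perm vs ws $$ (l, j))"
      using ij by (simp add: perm_def adj_matrix_def scalar_prod_def)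
    also have "\<dots> = (\<Sum>l = 0..<?n. (\<lambda>y. ?a (ws ! i) y * (if y = ws ! j then 1 else 0)) (vs ! l))"
      using ij by (intro sum.cong refl) (simp add: left perm_idx)
    also have "\<dots> = (\<Sum>y\<in>pverts G. ?a (ws ! i) y * (if y = ws ! j then 1 else 0))"
      by (rule sum_enum) (use vs in auto)
    also have "\<dots> = (\<Sum>y\<in>pverts G. if y = ws ! j then ?a (ws ! i) y else 0)"
      by (rule sum.cong) auto
    also have "\<dots> = adj_matrix G ws $$ (i, j)"
      using ij fin nthG[OF ws(2) len, of j] by (simp add: adj_matrix_def len)
    finally show "(perm ws vs * adj_matrix G vs * perm vs ws) $$ (i, j) = adj_matrix G ws $$ (i, j)" .
  qed (simp_all add: perm_def adj_matrix_def len)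
  have "similar_mat_wit (adj_matrix G ws) (adj_matrix G vs) (perm ws vs) (perm vs ws)"
    unfolding similar_mat_wit_def Let_def
    using inv[OF ws len vs refl] inv[OF vs refl ws len] conj dims
    by (auto simp: adj_matrix_def len)
  then have "char_poly (adj_matrix G ws) = char_poly (adj_matrix G vs)"
    by (metis char_poly_similar similar_mat_def)
  then show ?thesis
    by (simp add: adj_spectrum_def ws_def)
qed

text \<open>
  For every \<open>k \<ge> 1\<close> some member of the family has a clique graph isomorphic to the path on
  \<open>k\<close> vertices: \<open>k\<close> triangles in a row, the \<open>i\<close>-th one on \<open>block i\<close>.
\<close>

definition block :: "nat \<Rightarrow> nat set" where
  "block i = {2 * i..2 * i + 2}"

definition triangle_chain :: "nat \<Rightarrow> nat pair_pre_digraph" where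
  "triangle_chain k = \<lparr>pverts = {..2 * k},
     parcs = {(u, v). u \<noteq> v \<and> (\<exists>i<k. u \<in> block i \<and> v \<in> block i)}\<rparr>"

lemma triangle_chain_in_family: "triangle_chain (Suc k) \<in> triangle_family"
proof (induction k)
  let ?D = "\<lambda>i. \<lparr>pverts = block i, parcs = {(u, v). (u, v) \<in> block i \<times> block i \<and> u \<noteq> v}\<rparr>"
  have D: "K\<^bsub>3\<^esub> (with_proj (?D i))" for i
    by (simp add: complete_digraph_pair_def block_def)
  case 0
  have "triangle_chain (Suc 0) = ?D 0"
    by (auto simp: triangle_chain_def block_def)
  then show ?case
    using triangle_family.triangle[OF D] by simp
next
  let ?D = "\<lambda>i. \<lparr>pverts = block i, parcs = {(u, v). (u, v) \<in> block i \<times> block i \<and> u \<noteq> v}\<rparr>"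
  have D: "K\<^bsub>3\<^esub> (with_proj (?D i))" for i
    by (simp add: complete_digraph_pair_def block_def)
  case (Suc k)
  let ?v = "2 * Suc k"
  have v: "?v \<in> pverts (triangle_chain (Suc k))"
    by (simp add: triangle_chain_def)
  have "out_arcs (with_proj (triangle_chain (Suc k))) ?v = {(?v, 2 * k), (?v, 2 * k + 1)}"
  proof -
    have "(?v, w) \<in> parcs (triangle_chain (Suc k)) \<longleftrightarrow> w = 2 * k \<or> w = 2 * k + 1" for w
    proof
      assume "(?v, w) \<in> parcs (triangle_chain (Suc k))"
      then obtain i where "i < Suc k" "?v \<in> block i" "w \<in> block i" "w \<noteq> ?v"
        by (auto simp: triangle_chain_def)
      moreover from this have "i = k"
        by (auto simp: block_def)
      ultimately show "w = 2 * k \<or> w = 2 * k + 1"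
        by (auto simp: block_def)
    next
      assume "w = 2 * k \<or> w = 2 * k + 1"
      then have "w \<noteq> ?v" "?v \<in> block k" "w \<in> block k" "k < Suc k"
        by (auto simp: block_def)
      then show "(?v, w) \<in> parcs (triangle_chain (Suc k))"
        unfolding triangle_chain_def pair_pre_digraph.simps by blast
    qed
    then have "{w. (?v, w) \<in> parcs (triangle_chain (Suc k))} = {2 * k, 2 * k + 1}"
      by blast
    moreover have "out_arcs (with_proj H) u = Pair u ` {w. (u, w) \<in> parcs H}"
      for H :: "nat pair_pre_digraph" and u
      by (auto simp: out_arcs_def)
    ultimately show ?thesis
      by simp
  qed
  then have deg: "out_degree (with_proj (triangle_chain (Suc k))) ?v = 2"
    by (simp add: out_degree_def)
  have int: "pverts (triangle_chain (Suc k)) \<inter> pverts (?D (Suc k)) = {?v}"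
    by (auto simp: triangle_chain_def block_def)
  have "triangle_chain (Suc (Suc k)) =
      \<lparr>pverts = pverts (triangle_chain (Suc k)) \<union> pverts (?D (Suc k)),
       parcs = parcs (triangle_chain (Suc k)) \<union> parcs (?D (Suc k))\<rparr>"
    unfolding triangle_chain_def by (auto simp: block_def less_Suc_eq)
  then show ?case
    using triangle_family.glue[OF Suc v deg D int] by simp
qed

lemma block_inj: "block i \<subseteq> block j \<Longrightarrow> i = j"
  by (auto simp: block_def)

lemma max_cliques_triangle_chain:
  assumes "k \<ge> 1"
  shows "max_cliques (triangle_chain k) = block ` {..<k}"
proof -
  have blk: "is_clique (triangle_chain k) (block i)" if "i < k" for i
    using that by (fastforce simp: is_clique_def triangle_chain_def block_def)
  have sub: "\<exists>i<k. Q \<subseteq> block i" if Q: "is_clique (triangle_chain k) Q" for Q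
  proof -
    define m where "m = Min Q"
    have Q': "Q \<noteq> {}" "Q \<subseteq> {..2 * k}"
      using Q by (auto simp: is_clique_def triangle_chain_def)
    then have "finite Q"
      using finite_subset by blast
    with Q' have m: "m \<in> Q" "\<And>v. v \<in> Q \<Longrightarrow> m \<le> v"
      by (auto simp: m_def)
    define i where "i = min (m div 2) (k - 1)"
    have "v \<in> block i" if v: "v \<in> Q" for v
    proof (cases "v = m")
      case True
      then show ?thesis
        using m(1) Q' assms by (auto simp: block_def i_def min_def)
    next
      case False
      then have "(m, v) \<in> parcs (triangle_chain k)"
        using Q m v unfolding is_clique_def by metis
      then obtain j where j: "j < k" "m \<in> block j" "v \<in> block j"
        by (auto simp: triangle_chain_def)
      moreover have "m < v"
        using m(2)[OF v] False by simp
      ultimately have "m div 2 = j"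
        by (auto simp: block_def)
      then show ?thesis
        using j by (auto simp: i_def min_def)
    qed
    moreover have "i < k"
      using assms by (simp add: i_def)
    ultimately show ?thesis
      by blast
  qed
  show ?thesis
  proof (intro equalityI subsetI)
    fix Q assume "Q \<in> max_cliques (triangle_chain k)"
    then show "Q \<in> block ` {..<k}"
      using sub blk unfolding max_cliques_def by blast
  next
    fix Q assume "Q \<in> block ` {..<k}"
    then obtain i where i: "i < k" "Q = block i"
      by auto
    have "R = Q" if "is_clique (triangle_chain k) R" "Q \<subseteq> R" for R
      using sub[OF that(1)] that(2) i block_inj by (metis order.trans subset_antisym)
    then show "Q \<in> max_cliques (triangle_chain k)"
      using blk i by (auto simp: max_cliques_def)
  qed
qed

lemma clique_graph_triangle_chain:
  assumes "k \<ge> 1"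
  shows "digraph_iso (with_proj (clique_graph (triangle_chain k))) (with_proj (path_graph k))"
proof -
  define f :: "(nat, nat \<times> nat, nat set, nat set \<times> nat set) digraph_isomorphism" where
    "f = \<lparr>iso_verts = block, iso_arcs = map_prod block block, iso_head = snd, iso_tail = fst\<rparr>"
  have inj: "inj block"
    by (auto intro!: injI block_inj)
  have wf: "wf_digraph (with_proj (path_graph k))"
    by unfold_locales (auto simp: path_graph_def)
  have "pre_digraph.digraph_isomorphism (with_proj (path_graph k)) f"
    using wf inj by (auto simp: pre_digraph.digraph_isomorphism_def f_def
        intro: inj_on_subset prod.inj_map)
  moreover have "with_proj (clique_graph (triangle_chain k)) = app_iso f (with_proj (path_graph k))"
  proof -
    have meet: "block i \<noteq> block j \<and> block i \<inter> block j \<noteq> {} \<longleftrightarrow> j = Suc i \<or> i = Suc j" for i j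
    proof
      assume "block i \<noteq> block j \<and> block i \<inter> block j \<noteq> {}"
      then obtain x where "x \<in> block i" "x \<in> block j" "i \<noteq> j"
        by auto
      then show "j = Suc i \<or> i = Suc j"
        by (auto simp: block_def)
    next
      assume ij: "j = Suc i \<or> i = Suc j"
      then have "2 * max i j \<in> block i \<inter> block j"
        by (auto simp: block_def)
      moreover have "block i \<noteq> block j"
        using ij block_inj[of i j] by auto
      ultimately show "block i \<noteq> block j \<and> block i \<inter> block j \<noteq> {}"
        by blast
    qed
    have "parcs (clique_graph (triangle_chain k)) = map_prod block block ` parcs (path_graph k)"
    proof -
      have "parcs (clique_graph (triangle_chain k)) =
          {(Q, R). \<exists>i<k. \<exists>j<k. Q = block i \<and> R = block j \<and> block i \<noteq> block j \<and> block i \<inter> block j \<noteq> {}}"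
        using assms by (auto simp: clique_graph_def max_cliques_triangle_chain)
      also have "\<dots> = map_prod block block ` parcs (path_graph k)"
        unfolding meet by (auto simp: path_graph_def image_iff)
      finally show ?thesis .
    qed
    then show ?thesis
      using assms
      by (simp add: with_proj_def app_iso_def f_def clique_graph_def max_cliques_triangle_chain path_graph_def)
  qed
  ultimately have "digraph_iso (with_proj (path_graph k)) (with_proj (clique_graph (triangle_chain k)))"
    unfolding digraph_iso_def by blast
  then show ?thesis
    using wf digraph_iso_swap by blast
qed

lemma triangle_family_with_path_clique_graph_exists:
  assumes "k \<ge> 1"
  shows "\<exists>H :: nat pair_pre_digraph. H \<in> triangle_family \<and>
    digraph_iso (with_proj (clique_graph H)) (with_proj (path_graph k))"
  using assms triangle_chain_in_family[of "k - 1"] clique_graph_triangle_chain[of k] by auto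

end

theory Submission
  imports Defs
begin

text \<open>
  The spectrum determines the number of vertices and the number of closed walks of length six, the
  trace of the sixth power of the adjacency matrix. Gluing a triangle at a vertex of degree 2 with
  neighbours \<open>p\<close> and \<open>q\<close> increases this trace by \<open>186 + 12 (deg p + deg q)\<close>. All degrees are 2 or 4,
  and as soon as there are two triangles every vertex of degree 2 has a neighbour of degree 4, so
  the trace grows least when exactly one of \<open>p\<close>, \<open>q\<close> has degree 4. Starting from a chain of triangles,
  this means gluing at one of its ends and yields a longer chain; any other gluing creates a
  triangle all of whose vertices have degree 4, which persists. Hence among the members with a given
  number of triangles the chain is the only one of minimal trace, and it is also the only one
  without such a saturated triangle. A saturated triangle is a clique meeting three others, which
  cannot happen when the clique graph is a path.
\<close>

section \<open>Power sums of the spectrum\<close>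

definition trace_mat :: "'a::comm_ring_1 mat \<Rightarrow> 'a" where
  "trace_mat A = (\<Sum>i<dim_row A. A $$ (i, i))"

lemma trace_mat_mult:
  assumes "A \<in> carrier_mat n m" "B \<in> carrier_mat m n"
  shows "trace_mat (A * B) = (\<Sum>i<n. \<Sum>j<m. A $$ (i, j) * B $$ (j, i))"
  using assms by (auto simp: trace_mat_def scalar_prod_def atLeast0LessThan intro!: sum.cong)

lemma trace_mat_mult_commute:
  assumes "A \<in> carrier_mat n m" "B \<in> carrier_mat m n"
  shows "trace_mat (A * B) = trace_mat (B * A)"
  unfolding trace_mat_mult[OF assms] trace_mat_mult[OF assms(2,1)]
  by (subst sum.swap) (simp add: mult.commute)

lemma trace_mat_similar:
  assumes "similar_mat_wit A B P Q"
  shows "trace_mat A = trace_mat B"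
proof -
  note D = similar_mat_witD[OF refl assms]
  have "trace_mat A = trace_mat (P * (B * Q))"
    by (subst D(3)) (simp only: assoc_mult_mat[OF D(6,5,7)])
  also have "\<dots> = trace_mat (B * Q * P)"
    by (rule trace_mat_mult_commute[OF D(6) mult_carrier_mat[OF D(5,7)]])
  also have "B * Q * P = B"
    by (simp only: assoc_mult_mat[OF D(5,7,6)] D(2) right_mult_one_mat[OF D(5)])
  finally show ?thesis .
qed

lemma upper_triangular_pow_mat:
  fixes B :: "'a::comm_ring_1 mat"
  assumes B: "B \<in> carrier_mat n n" and ut: "upper_triangular B"
  shows "upper_triangular (B ^\<^sub>m k) \<and> (\<forall>i<n. (B ^\<^sub>m k) $$ (i, i) = (B $$ (i, i)) ^ k)"
proof (induction k)
  case 0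
  then show ?case using B by auto
next
  case (Suc k)
  let ?C = "B ^\<^sub>m k"
  have C: "?C \<in> carrier_mat n n"
    using B by simp
  have entry: "(?C * B) $$ (i, j) = (\<Sum>l<n. ?C $$ (i, l) * B $$ (l, j))" if "i < n" "j < n" for i j
    using that B C by (auto simp: scalar_prod_def atLeast0LessThan intro!: sum.cong)
  \<comment> \<open>In a product of upper triangular matrices a summand can survive only for
    \<open>i <= l <= j\<close>: none is left below the diagonal, and only \<open>l = i\<close> on
    it.\<close>
  have zero: "?C $$ (i, l) * B $$ (l, j) = 0" if "i < n" "l < n" "l < i \<or> j < l" for i j l
    using that upper_triangularD[OF ut, of j l] upper_triangularD[of ?C l i] Suc B C by auto
  have "(?C * B) $$ (i, j) = 0" if "j < i" "i < n" for i j
    using that by (subst entry) (auto intro!: sum.neutral zero)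
  moreover have "(?C * B) $$ (i, i) = (B $$ (i, i)) ^ Suc k" if i: "i < n" for i
  proof -
    have "(\<Sum>l<n. ?C $$ (i, l) * B $$ (l, i)) = (\<Sum>l\<in>{i}. ?C $$ (i, l) * B $$ (l, i))"
      using i by (intro sum.mono_neutral_right) (auto intro!: zero)
    then show ?thesis
      using i Suc by (simp add: entry mult.commute)
  qed
  ultimately show ?case
    using B C by (auto intro!: upper_triangularI)
qed

text \<open>Over the complex numbers the Schur decomposition makes \<open>A\<close> similar to an
  upper triangular matrix whose diagonal lists the eigenvalues with multiplicity. Powers act
  entrywise on that diagonal, and similarity preserves the trace.\<close>

lemma trace_pow_mat_eq_sum_proots:
  fixes A :: "complex mat"
  assumes A: "A \<in> carrier_mat n n"
  shows "trace_mat (A ^\<^sub>m k) = (\<Sum>x\<in>#proots (char_poly A). x ^ k)"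
proof -
  obtain as where as: "char_poly A = (\<Prod>a\<leftarrow>as. [:- a, 1:])" "length as = n"
    using char_poly_factorized[OF A] by auto
  obtain B P Q where "schur_decomposition A as = (B, P, Q)"
    by (cases "schur_decomposition A as")
  from schur_decomposition[OF A as(1) this]
  have sim: "similar_mat_wit A B P Q" and ut: "upper_triangular B" and diag: "diag_mat B = as"
    by auto
  have B: "B \<in> carrier_mat n n"
    using similar_mat_witD2[OF A sim] by simp
  have "proots (char_poly A) = (\<Sum>p\<leftarrow>map (\<lambda>a. [:- a, 1:]) as. proots p)"
    unfolding as(1) by (subst proots_prod_list[symmetric]) auto
  also have "\<dots> = mset as"
    by (induction as) auto
  finally have roots: "proots (char_poly A) = mset as" .
  have "trace_mat (A ^\<^sub>m k) = trace_mat (B ^\<^sub>m k)"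
    by (rule trace_mat_similar[OF similar_mat_wit_pow[OF sim]])
  also have "\<dots> = (\<Sum>i<n. (B $$ (i, i)) ^ k)"
    using upper_triangular_pow_mat[OF B ut, of k] B by (auto simp: trace_mat_def intro!: sum.cong)
  also have "\<dots> = (\<Sum>x\<leftarrow>as. x ^ k)"
    using B unfolding diag[symmetric] diag_mat_def
    by (simp add: sum_list_sum_nth atLeast0LessThan comp_def)
  also have "\<dots> = (\<Sum>x\<in>#proots (char_poly A). x ^ k)"
    unfolding roots by (metis mset_map sum_mset_sum_list)
  finally show ?thesis .
qed

section \<open>Walk counts and their relation to the spectrum\<close>

definition adj :: "'a pair_pre_digraph \<Rightarrow> 'a \<Rightarrow> 'a \<Rightarrow> int" where
  "adj G u v = of_bool ((u, v) \<in> parcs G)"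

definition walk2 :: "'a pair_pre_digraph \<Rightarrow> 'a \<Rightarrow> 'a \<Rightarrow> int" where
  "walk2 G u v = (\<Sum>x\<in>pverts G. adj G u x * adj G x v)"

definition walk3 :: "'a pair_pre_digraph \<Rightarrow> 'a \<Rightarrow> 'a \<Rightarrow> int" where
  "walk3 G u v = (\<Sum>x\<in>pverts G. walk2 G u x * adj G x v)"

text \<open>The trace of the sixth power of the adjacency matrix, read as the trace of the square of
  its cube: a closed walk is cut at its midpoint, so that only walks of length three have to be
  counted.\<close>

definition closed6 :: "'a pair_pre_digraph \<Rightarrow> int" where
  "closed6 G = (\<Sum>u\<in>pverts G. \<Sum>v\<in>pverts G. walk3 G u v * walk3 G v u)"

text \<open>The characteristic polynomial splits over the complex numbers and its degree is the
  number of vertices. In the family this number determines the number of triangles.\<close>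

lemma size_adj_spectrum:
  assumes "finite (pverts G)"
  shows "size (adj_spectrum G) = card (pverts G)"
proof -
  obtain vs where vs: "distinct vs" "set vs = pverts G"
    using finite_distinct_list[OF assms] by auto
  have "adj_matrix G vs \<in> carrier_mat (length vs) (length vs)"
    by (simp add: adj_matrix_def)
  from degree_monic_char_poly[OF this] show ?thesis
    using vs by (simp add: adj_spectrum_enum[OF vs] size_proots_complex distinct_card flip: vs(2))
qed

lemma closed6_eq_sum_adj_spectrum:
  assumes "finite (pverts G)"
  shows "complex_of_int (closed6 G) = (\<Sum>x\<in>#adj_spectrum G. x ^ 6)"
proof -
  obtain vs where vs: "distinct vs" "set vs = pverts G"
    using finite_distinct_list[OF assms] by auto
  define n where "n = length vs"
  define A where "A = adj_matrix G vs"
  have A: "A \<in> carrier_mat n n"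
    by (simp add: A_def n_def adj_matrix_def)
  have sum_vs: "(\<Sum>i<n. f (vs ! i)) = sum f (pverts G)" for f :: "'a \<Rightarrow> complex"
    using sum.reindex_bij_betw[OF bij_betw_nth[OF vs(1) refl refl], of f] vs by (simp add: n_def)
  have adjA: "A $$ (i, j) = of_int (adj G (vs ! i) (vs ! j))" if "i < n" "j < n" for i j
    using that by (simp add: A_def adj_matrix_def n_def adj_def)
  \<comment> \<open>Right multiplication by \<open>A\<close> appends one arc to the walks counted by
    \<open>f\<close>; this turns \<open>adj\<close> into \<open>walk2\<close> and
    \<open>walk2\<close> into \<open>walk3\<close>.\<close>
  have step: "(B * A) $$ (i, j) = of_int (\<Sum>x\<in>pverts G. f (vs ! i) x * adj G x (vs ! j))"
    if B: "B \<in> carrier_mat n n" and ij: "i < n" "j < n"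
      and f: "\<And>i j. i < n \<Longrightarrow> j < n \<Longrightarrow> B $$ (i, j) = of_int (f (vs ! i) (vs ! j))" for B f i j
  proof -
    have "(B * A) $$ (i, j) = (\<Sum>l<n. B $$ (i, l) * A $$ (l, j))"
      using ij B A by (auto simp: scalar_prod_def atLeast0LessThan intro!: sum.cong)
    also have "\<dots> = (\<Sum>l<n. (\<lambda>x. of_int (f (vs ! i) x * adj G x (vs ! j))) (vs ! l))"
      using ij by (intro sum.cong) (auto simp: f adjA)
    also have "\<dots> = of_int (\<Sum>x\<in>pverts G. f (vs ! i) x * adj G x (vs ! j))"
      by (subst sum_vs) simp
    finally show ?thesis .
  qed
  have A2: "(A * A) $$ (i, j) = of_int (walk2 G (vs ! i) (vs ! j))" if "i < n" "j < n" for i j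
    unfolding walk2_def using that by (intro step A adjA)
  have A3: "(A * A * A) $$ (i, j) = of_int (walk3 G (vs ! i) (vs ! j))" if "i < n" "j < n" for i j
    unfolding walk3_def using that A by (intro step A2) auto
  let ?C = "A * A * A"
  have C: "?C \<in> carrier_mat n n"
    using A by simp
  have "A ^\<^sub>m 6 = ?C * ?C"
    using A by (simp add: numeral_eq_Suc assoc_mult_mat[of _ n n _ n _ n])
  then have "(\<Sum>x\<in>#adj_spectrum G. x ^ 6) = trace_mat (?C * ?C)"
    using trace_pow_mat_eq_sum_proots[OF A, of 6] by (simp add: adj_spectrum_enum[OF vs] A_def)
  also have "\<dots> = (\<Sum>i<n. \<Sum>j<n. of_int (walk3 G (vs ! i) (vs ! j) * walk3 G (vs ! j) (vs ! i)))"
    unfolding trace_mat_mult[OF C C] by (intro sum.cong refl) (simp add: A3 del: index_mult_mat)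
  also have "\<dots> = (\<Sum>i<n. (\<lambda>u. \<Sum>v\<in>pverts G. of_int (walk3 G u v * walk3 G v u)) (vs ! i))"
    using sum_vs[of "\<lambda>v. of_int (walk3 G (vs ! i) v * walk3 G v (vs ! i))" for i] by simp
  also have "\<dots> = of_int (closed6 G)"
    by (subst sum_vs) (simp add: closed6_def)
  finally show ?thesis by simp
qed

section \<open>Closed walks of length six\<close>

definition nbrs :: "'a pair_pre_digraph \<Rightarrow> 'a \<Rightarrow> 'a set" where
  "nbrs G u = {w. (u, w) \<in> parcs G}"

text \<open>The local structure on which the walk counts rest: besides being finite, simple and
  undirected, the graph has exactly one triangle on each edge.\<close>

definition triangular :: "'a pair_pre_digraph \<Rightarrow> bool" where
  "triangular G \<longleftrightarrow> finite (pverts G) \<and> parcs G \<subseteq> pverts G \<times> pverts G \<and> irrefl (parcs G) \<and> sym (parcs G) \<and>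
     (\<forall>(x, y) \<in> parcs G. card (nbrs G x \<inter> nbrs G y) = 1)"

definition attach :: "'a pair_pre_digraph \<Rightarrow> 'a \<Rightarrow> 'a \<Rightarrow> 'a \<Rightarrow> 'a pair_pre_digraph" where
  "attach H v a b = \<lparr>pverts = insert a (insert b (pverts H)),
     parcs = parcs H \<union> {(v, a), (a, v), (v, b), (b, v), (a, b), (b, a)}\<rparr>"

lemma attach_commute: "attach H v a b = attach H v b a"
  by (auto simp: attach_def)

lemma out_degree_eq_card_nbrs: "out_degree (with_proj G) u = card (nbrs G u)"
proof -
  have "out_arcs (with_proj G) u = Pair u ` nbrs G u"
    by (auto simp: out_arcs_def nbrs_def)
  then show ?thesis
    by (simp add: out_degree_def card_image inj_on_def)
qed

text \<open>A complete graph on three vertices that meets \<open>H\<close> only in \<open>v\<close>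
  consists of \<open>v\<close> and two fresh vertices, so each gluing is an \<open>attach\<close>
  with explicitly known arcs.\<close>

lemma triangle_family_induct [consumes 1, case_names triangle attach]:
  assumes "G \<in> triangle_family"
    and tri: "\<And>x y z. distinct [x, y, z] \<Longrightarrow>
      P \<lparr>pverts = {x, y, z}, parcs = {(x, y), (y, x), (x, z), (z, x), (y, z), (z, y)}\<rparr>"
    and att: "\<And>H v a b. H \<in> triangle_family \<Longrightarrow> P H \<Longrightarrow> v \<in> pverts H \<Longrightarrow> card (nbrs H v) = 2 \<Longrightarrow>
      a \<notin> pverts H \<Longrightarrow> b \<notin> pverts H \<Longrightarrow> a \<noteq> b \<Longrightarrow> P (attach H v a b)"
  shows "P G"
  using assms(1)
proof induction
  case (triangle D)
  then have "card (pverts D) = 3" and arcs: "parcs D = {(u, v). (u, v) \<in> pverts D \<times> pverts D \<and> u \<noteq> v}"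
    by (auto simp: complete_digraph_pair_def)
  then obtain x y z where xyz: "pverts D = {x, y, z}" "distinct [x, y, z]"
    by (auto simp: card_3_iff)
  then have "parcs D = {(x, y), (y, x), (x, z), (z, x), (y, z), (z, y)}"
    unfolding arcs by auto
  then show ?case
    using tri[OF xyz(2)] xyz(1) by (metis (full_types) pair_pre_digraph.surjective old.unit.exhaust)
next
  case (glue H v D)
  then have card: "card (pverts D) = 3" and arcs: "parcs D = {(u, v). (u, v) \<in> pverts D \<times> pverts D \<and> u \<noteq> v}"
    by (auto simp: complete_digraph_pair_def)
  have v: "v \<in> pverts D"
    using glue by auto
  then have "card (pverts D - {v}) = 2"
    using card by simp
  then obtain a b where ab: "pverts D - {v} = {a, b}" "a \<noteq> b"
    by (auto simp: card_2_iff)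
  then have D: "pverts D = {v, a, b}" "a \<noteq> v" "b \<noteq> v"
    using v by auto
  then have "a \<notin> pverts H" "b \<notin> pverts H"
    using glue.hyps by auto
  moreover have "parcs D = {(v, a), (a, v), (v, b), (b, v), (a, b), (b, a)}"
    unfolding arcs D(1) using D(2,3) ab(2) by auto
  then have "\<lparr>pverts = pverts H \<union> pverts D, parcs = parcs H \<union> parcs D\<rparr> = attach H v a b"
    using glue.hyps(2) by (auto simp: attach_def D(1))
  ultimately show ?case
    using att[of H v a b] glue ab(2) by (simp add: out_degree_eq_card_nbrs)
qed

lemma triangularD:
  assumes "triangular G"
  shows "finite (pverts G)"
    and "(x, y) \<in> parcs G \<Longrightarrow> x \<in> pverts G"
    and "(x, y) \<in> parcs G \<Longrightarrow> y \<in> pverts G"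
    and "(x, x) \<notin> parcs G"
    and "(x, y) \<in> parcs G \<Longrightarrow> (y, x) \<in> parcs G"
    and "(x, y) \<in> parcs G \<Longrightarrow> \<exists>z. (x, z) \<in> parcs G \<and> (y, z) \<in> parcs G"
    and "\<lbrakk>(x, y) \<in> parcs G; (x, z) \<in> parcs G; (y, z) \<in> parcs G; (x, z') \<in> parcs G; (y, z') \<in> parcs G\<rbrakk> \<Longrightarrow> z = z'"
proof -
  have one: "\<exists>z. nbrs G x \<inter> nbrs G y = {z}" if "(x, y) \<in> parcs G"
    using assms that unfolding triangular_def by (auto simp: card_1_singleton_iff)
  show "\<exists>z. (x, z) \<in> parcs G \<and> (y, z) \<in> parcs G" if "(x, y) \<in> parcs G"
    using one[OF that] by (auto simp: nbrs_def)
  show "z = z'" if "(x, y) \<in> parcs G" "(x, z) \<in> parcs G" "(y, z) \<in> parcs G" "(x, z') \<in> parcs G" "(y, z') \<in> parcs G"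
  proof -
    from one[OF that(1)] obtain t where "nbrs G x \<inter> nbrs G y = {t}"
      by blast
    moreover have "z \<in> nbrs G x \<inter> nbrs G y" "z' \<in> nbrs G x \<inter> nbrs G y"
      using that by (simp_all add: nbrs_def)
    ultimately show ?thesis
      by simp
  qed
  show "(y, x) \<in> parcs G" if "(x, y) \<in> parcs G"
    using assms that by (auto simp: triangular_def dest: symD)
qed (use assms in \<open>auto simp: triangular_def irrefl_def\<close>)

lemma finite_nbrs: "triangular G \<Longrightarrow> finite (nbrs G x)"
  by (rule finite_subset[of _ "pverts G"]) (auto simp: nbrs_def triangularD)

lemma triangular_triangle:
  assumes "distinct [x, y, z]"
  shows "triangular \<lparr>pverts = {x, y, z}, parcs = {(x, y), (y, x), (x, z), (z, x), (y, z), (z, y)}\<rparr>"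
    (is "triangular ?T")
proof -
  have "nbrs ?T x = {y, z}" "nbrs ?T y = {x, z}" "nbrs ?T z = {x, y}"
    using assms by (auto simp: nbrs_def)
  then show ?thesis
    using assms by (auto simp: triangular_def irrefl_def sym_def)
qed

lemma nbrs_attach:
  assumes "triangular H" "v \<in> pverts H" "a \<notin> pverts H" "b \<notin> pverts H" "a \<noteq> b"
  shows "x \<in> pverts H \<Longrightarrow> x \<noteq> v \<Longrightarrow> nbrs (attach H v a b) x = nbrs H x"
    and "nbrs (attach H v a b) v = nbrs H v \<union> {a, b}"
    and "nbrs (attach H v a b) a = {v, b}"
    and "nbrs (attach H v a b) b = {v, a}"
  using assms triangularD(2,3)[OF assms(1)] by (auto simp: nbrs_def attach_def)

lemma card_nbrs_attach:
  assumes "triangular H" "v \<in> pverts H" "a \<notin> pverts H" "b \<notin> pverts H" "a \<noteq> b"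
  shows "x \<in> pverts H \<Longrightarrow> x \<noteq> v \<Longrightarrow> card (nbrs (attach H v a b) x) = card (nbrs H x)"
    and "card (nbrs (attach H v a b) v) = card (nbrs H v) + 2"
    and "card (nbrs (attach H v a b) a) = 2"
    and "card (nbrs (attach H v a b) b) = 2"
proof -
  have "nbrs H v \<inter> {a, b} = {}"
    using assms triangularD(3)[OF assms(1)] by (auto simp: nbrs_def)
  then show "card (nbrs (attach H v a b) v) = card (nbrs H v) + 2"
    using assms finite_nbrs[OF assms(1)] by (simp add: nbrs_attach card_Un_disjoint del: Un_insert_right)
  have "v \<noteq> a" "v \<noteq> b"
    using assms by auto
  then show "card (nbrs (attach H v a b) a) = 2" "card (nbrs (attach H v a b) b) = 2"
    using assms by (simp_all add: nbrs_attach)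
qed (simp add: nbrs_attach[OF assms])

lemma triangular_attach:
  assumes H: "triangular H" and v: "v \<in> pverts H" and ab: "a \<notin> pverts H" "b \<notin> pverts H" "a \<noteq> b"
  shows "triangular (attach H v a b)"
proof -
  let ?G = "attach H v a b"
  note D = triangularD[OF H]
  have V: "(a, x) \<notin> parcs H" "(b, x) \<notin> parcs H" "(x, a) \<notin> parcs H" "(x, b) \<notin> parcs H" for x
    using ab D(2,3) by auto
  have ne: "v \<noteq> a" "v \<noteq> b"
    using v ab by auto
  have "card (nbrs ?G x \<inter> nbrs ?G y) = 1" if "(x, y) \<in> parcs ?G" for x y
  proof (cases "(x, y) \<in> parcs H")
    \<comment> \<open>The only old neighbour of \<open>a\<close> and of \<open>b\<close> is
      \<open>v\<close>, so neither is a common neighbour of both ends of an old arc.\<close>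
    case True
    then have "nbrs ?G x \<inter> nbrs ?G y = nbrs H x \<inter> nbrs H y"
      using V ne ab(3) D(4) by (auto simp: attach_def nbrs_def)
    then show ?thesis
      using True H by (auto simp: triangular_def)
  next
    case False
    \<comment> \<open>Both ends lie in the new triangle. Its third vertex is their only common
      neighbour, because the remaining neighbours of \<open>v\<close> are old and not adjacent to
      \<open>a\<close> or \<open>b\<close>.\<close>
    have disj: "nbrs H v \<inter> {v, a, b} = {}"
      using V D(4) by (auto simp: nbrs_def)
    have "x \<in> {v, a, b} \<and> y \<in> {v, a, b} \<and> x \<noteq> y"
      using False that ne ab(3) by (auto simp: attach_def)
    then show ?thesis
      using disj ne ab(3) by (auto simp: nbrs_attach[OF H v ab] Int_insert_left Int_insert_right)
  qed
  moreover have "irrefl (parcs ?G)" "sym (parcs ?G)" "finite (pverts ?G)"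
      "parcs ?G \<subseteq> pverts ?G \<times> pverts ?G"
    using D(1-5) v ne ab unfolding irrefl_def sym_def by (auto simp: attach_def)
  ultimately show ?thesis
    unfolding triangular_def by blast
qed

section \<open>Elementary properties of the walk counts\<close>

lemma sum_of_bool_eq_times:
  fixes f :: "'a \<Rightarrow> int"
  assumes "finite V" "v \<in> V"
  shows "(\<Sum>x\<in>V. of_bool (x = v) * f x) = f v"
    and "(\<Sum>x\<in>V. f x * of_bool (x = v)) = f v"
proof -
  have "(\<Sum>x\<in>V. of_bool (x = v) * f x) = (\<Sum>x\<in>V. if x = v then f x else 0)"
    by (intro sum.cong) auto
  then show "(\<Sum>x\<in>V. of_bool (x = v) * f x) = f v"
    using assms by simp
  then show "(\<Sum>x\<in>V. f x * of_bool (x = v)) = f v"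
    by (simp add: mult.commute)
qed

lemma adj_commute: "triangular G \<Longrightarrow> adj G x y = adj G y x"
  using triangularD(5)[of G] by (auto simp: adj_def)

lemma adj_self: "triangular G \<Longrightarrow> adj G x x = 0"
  using triangularD(4)[of G] by (auto simp: adj_def)

lemma adj_idem: "adj G x y * adj G x y = adj G x y"
  by (simp add: adj_def)

lemma sum_adj: "triangular G \<Longrightarrow> (\<Sum>y\<in>pverts G. adj G x y) = int (card (nbrs G x))"
proof -
  assume G: "triangular G"
  have "nbrs G x = {y \<in> pverts G. (x, y) \<in> parcs G}"
    using triangularD(3)[OF G] by (auto simp: nbrs_def)
  then show ?thesis
    using triangularD(1)[OF G] by (simp add: adj_def Int_def)
qed

lemma walk2_commute: "triangular G \<Longrightarrow> walk2 G x y = walk2 G y x"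
  unfolding walk2_def by (intro sum.cong refl) (metis adj_commute mult.commute)

lemma walk3_commute:
  assumes "triangular G"
  shows "walk3 G x y = walk3 G y x"
proof -
  have "walk3 G x y = (\<Sum>s\<in>pverts G. \<Sum>t\<in>pverts G. adj G x t * adj G t s * adj G s y)"
    by (simp add: walk3_def walk2_def sum_distrib_right)
  also have "\<dots> = (\<Sum>t\<in>pverts G. \<Sum>s\<in>pverts G. adj G x t * adj G t s * adj G s y)"
    by (rule sum.swap)
  also have "\<dots> = (\<Sum>t\<in>pverts G. \<Sum>s\<in>pverts G. adj G y s * adj G s t * adj G t x)"
    using adj_commute[OF assms] by (intro sum.cong refl) (simp add: mult_ac)
  also have "\<dots> = walk3 G y x"
    by (simp add: walk3_def walk2_def sum_distrib_right)
  finally show ?thesis .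
qed

lemma closed6_eq: "triangular G \<Longrightarrow> closed6 G = (\<Sum>u\<in>pverts G. \<Sum>v\<in>pverts G. (walk3 G u v)\<^sup>2)"
  by (simp add: closed6_def power2_eq_square walk3_commute)

lemma walk2_self: "triangular G \<Longrightarrow> walk2 G x x = int (card (nbrs G x))"
  unfolding walk2_def sum_adj[symmetric] by (intro sum.cong refl) (metis adj_commute adj_idem)

text \<open>A walk of length two between the ends of an arc passes through a common neighbour, and
  there is exactly one.\<close>

lemma walk2_arc:
  assumes G: "triangular G" and xy: "(x, y) \<in> parcs G"
  shows "walk2 G x y = 1"
proof -
  obtain z where z: "(x, z) \<in> parcs G" "(y, z) \<in> parcs G"
    using triangularD(6)[OF G xy] by blast
  have "(w, y) \<in> parcs G \<longleftrightarrow> (y, w) \<in> parcs G" for w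
    using triangularD(5)[OF G] by blast
  moreover have "(x, w) \<in> parcs G \<and> (y, w) \<in> parcs G \<longleftrightarrow> w = z" for w
    using triangularD(7)[OF G xy z] z by blast
  ultimately have "adj G x w * adj G w y = of_bool (w = z) * 1" for w
    by (simp add: adj_def flip: of_bool_conj)
  then show ?thesis
    unfolding walk2_def
    by (simp only: sum_of_bool_eq_times(1)[OF triangularD(1)[OF G] triangularD(3)[OF G z(1)]])
qed

section \<open>Walk counts before and after one gluing at a vertex of degree 2\<close>

locale attachment =
  fixes H :: "'a pair_pre_digraph" and v p q a b :: 'a
  assumes triangular: "triangular H"
    and v: "v \<in> pverts H"
    and nbrs_v: "nbrs H v = {p, q}"
    and pq: "p \<noteq> q"
    and new: "a \<notin> pverts H" "b \<notin> pverts H" "a \<noteq> b"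
begin

abbreviation "V \<equiv> pverts H"
abbreviation "G \<equiv> attach H v a b"
abbreviation e :: "'a \<Rightarrow> int" where "e x \<equiv> of_bool (x = v)"

lemma G: "triangular G"
  using triangular v new by (rule triangular_attach)

text \<open>The two new vertices are interchangeable, so results about \<open>a\<close> carry over
  to \<open>b\<close>.\<close>

lemma swap: "attachment H v p q b a"
  using triangular v nbrs_v pq new by unfold_locales auto

lemmas fin = triangularD(1)[OF triangular]

lemma arcs: "(v, p) \<in> parcs H" "(v, q) \<in> parcs H" "(p, v) \<in> parcs H" "(q, v) \<in> parcs H"
  "(p, q) \<in> parcs H" "(q, p) \<in> parcs H"
proof -
  show vp: "(v, p) \<in> parcs H" and vq: "(v, q) \<in> parcs H"
    using nbrs_v by (auto simp: nbrs_def)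
  then show "(p, v) \<in> parcs H" "(q, v) \<in> parcs H"
    using triangularD(5)[OF triangular] by auto
  \<comment> \<open>The arc from \<open>v\<close> to \<open>p\<close> lies in a triangle, whose
    third vertex is a neighbour of \<open>v\<close> other than \<open>p\<close>, hence
    \<open>q\<close>.\<close>
  obtain z where "(v, z) \<in> parcs H" "(p, z) \<in> parcs H"
    using triangularD(6)[OF triangular vp] by blast
  moreover from this have "z \<in> {p, q}" "z \<noteq> p"
    using nbrs_v triangularD(4)[OF triangular] by (auto simp flip: nbrs_v simp: nbrs_def)
  ultimately show "(p, q) \<in> parcs H"
    by auto
  then show "(q, p) \<in> parcs H"
    using triangularD(5)[OF triangular] by auto
qed

lemma pq_verts: "p \<in> V" "q \<in> V"
  using arcs triangularD(3)[OF triangular] by blast+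

lemma adj_v: "adj H v x = of_bool (x = p) + of_bool (x = q)"
  using nbrs_v pq by (auto simp: adj_def nbrs_def)

lemma walk2_v: "walk2 H v x = adj H p x + adj H q x"
  unfolding walk2_def adj_v using fin pq_verts
  by (simp only: distrib_right sum.distrib sum_of_bool_eq_times)

lemma walk3_v: "walk3 H v x = walk2 H p x + walk2 H q x"
  unfolding walk3_def walk2_v unfolding walk2_def
  by (simp only: distrib_right sum.distrib)

lemma walk3_v_values:
  "walk3 H v v = 2" "walk3 H v p = int (card (nbrs H p)) + 1" "walk3 H v q = int (card (nbrs H q)) + 1"
  using triangular arcs by (simp_all add: walk3_v walk2_arc walk2_self)

lemma new_distinct: "v \<noteq> a" "v \<noteq> b"
  using v new by auto

lemma adj_attach:
  "x \<in> V \<Longrightarrow> y \<in> V \<Longrightarrow> adj G x y = adj H x y"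
  "x \<in> V \<Longrightarrow> adj G x a = e x" "x \<in> V \<Longrightarrow> adj G x b = e x"
  "x \<in> V \<Longrightarrow> adj G a x = e x" "x \<in> V \<Longrightarrow> adj G b x = e x"
  "adj G a a = 0" "adj G b b = 0" "adj G a b = 1" "adj G b a = 1"
proof -
  have out: "(a, x) \<notin> parcs H" "(b, x) \<notin> parcs H" "(x, a) \<notin> parcs H" "(x, b) \<notin> parcs H" for x
    using new triangularD(2,3)[OF triangular] by auto
  have V: "x \<noteq> a" "x \<noteq> b" if "x \<in> V" for x
    using that new by auto
  show "adj G x y = adj H x y" if "x \<in> V" "y \<in> V"
    using V[OF that(1)] V[OF that(2)] by (simp add: adj_def attach_def)
  show "adj G x a = e x" "adj G x b = e x" "adj G a x = e x" "adj G b x = e x" if "x \<in> V"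
    using V[OF that] out new(3) new_distinct by (simp_all add: adj_def attach_def)
  show "adj G a a = 0" "adj G b b = 0" "adj G a b = 1" "adj G b a = 1"
    using out new(3) new_distinct by (simp_all add: adj_def attach_def)
qed

lemma sum_attach: "(\<Sum>x\<in>pverts G. f x) = f a + f b + (\<Sum>x\<in>V. f x)" for f :: "'a \<Rightarrow> int"
  using fin new by (simp add: attach_def)

text \<open>A new walk of length two between old vertices turns round in \<open>a\<close> or in
  \<open>b\<close>, so it leads from \<open>v\<close> back to \<open>v\<close>.\<close>

lemma walk2_attach:
  assumes "x \<in> V" "y \<in> V"
  shows "walk2 G x y = walk2 H x y + 2 * e x * e y"
proof -
  have "(\<Sum>t\<in>V. adj G x t * adj G t y) = walk2 H x y"
    unfolding walk2_def using assms by (intro sum.cong) (auto simp: adj_attach)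
  then show ?thesis
    using assms unfolding walk2_def[of G] sum_attach by (simp add: adj_attach)
qed

lemma walk2_attach_new:
  "x \<in> V \<Longrightarrow> walk2 G a x = adj H v x + e x"
  "walk2 G a a = 2" "walk2 G a b = 1"
proof -
  assume x: "x \<in> V"
  have "(\<Sum>t\<in>V. adj G a t * adj G t x) = (\<Sum>t\<in>V. e t * adj H t x)"
    using x by (intro sum.cong) (auto simp: adj_attach)
  then show "walk2 G a x = adj H v x + e x"
    using x fin v unfolding walk2_def[of G] sum_attach by (simp add: adj_attach sum_of_bool_eq_times)
next
  have "(\<Sum>t\<in>V. adj G a t * adj G t z) = (\<Sum>t\<in>V. e t * 1)" if "z = a \<or> z = b" for z
    using that by (intro sum.cong) (auto simp: adj_attach)
  then show "walk2 G a a = 2" "walk2 G a b = 1"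
    using fin v unfolding walk2_def[of G] sum_attach
    by (simp_all add: adj_attach sum_of_bool_eq_times del: mult_1_right)
qed

text \<open>The new walks use the glued triangle: a detour from \<open>v\<close> to \<open>a\<close>
  or \<open>b\<close> and back, before or after an old arc at \<open>v\<close>, or the whole
  triangle traversed in one of its two directions.\<close>

lemma walk3_attach:
  assumes "x \<in> V" "y \<in> V"
  shows "walk3 G x y = walk3 H x y + 2 * (e x * adj H v y + e y * adj H x v + e x * e y)"
proof -
  have xa: "walk2 G x a = adj H v x + e x" and xb: "walk2 G x b = adj H v x + e x"
    using assms G walk2_attach_new(1) attachment.walk2_attach_new(1)[OF swap]
    by (simp_all add: walk2_commute[of G x] attach_commute[of H v b a])
  have "(\<Sum>t\<in>V. walk2 G x t * adj G t y) = (\<Sum>t\<in>V. walk2 H x t * adj H t y + 2 * e x * (e t * adj H t y))"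
    using assms by (intro sum.cong) (auto simp: adj_attach walk2_attach distrib_right)
  also have "\<dots> = walk3 H x y + 2 * e x * adj H v y"
    unfolding sum.distrib sum_distrib_left[symmetric] walk3_def using fin v by (simp add: sum_of_bool_eq_times)
  finally show ?thesis
    using assms triangular unfolding walk3_def[of G] sum_attach
    by (simp add: adj_attach xa xb algebra_simps adj_commute[of H x v])
qed

text \<open>From \<open>a\<close> one reaches an old vertex by \<open>v\<close> and two old arcs, or
  by \<open>b\<close>, \<open>v\<close> and one old arc. The summand \<open>3 * e x\<close> counts
  the walks \<open>a v a v\<close>, \<open>a v b v\<close> and \<open>a b a v\<close>.\<close>

lemma walk3_attach_new:
  "x \<in> V \<Longrightarrow> walk3 G a x = walk2 H v x + adj H v x + 3 * e x"
  "walk3 G a a = 2" "walk3 G a b = 3"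
proof -
  assume x: "x \<in> V"
  have "(\<Sum>t\<in>V. walk2 G a t * adj G t x) = (\<Sum>t\<in>V. adj H v t * adj H t x + e t * adj H t x)"
    using x by (intro sum.cong) (auto simp: adj_attach walk2_attach_new algebra_simps)
  also have "\<dots> = walk2 H v x + adj H v x"
    unfolding sum.distrib walk2_def using fin v by (simp add: sum_of_bool_eq_times)
  finally show "walk3 G a x = walk2 H v x + adj H v x + 3 * e x"
    using x unfolding walk3_def[of G] sum_attach by (simp add: adj_attach walk2_attach_new)
next
  have "(\<Sum>t\<in>V. walk2 G a t * adj G t z) = (\<Sum>t\<in>V. e t * (adj H v t + 1))" if "z = a \<or> z = b" for z
    using that by (intro sum.cong) (auto simp: adj_attach walk2_attach_new)
  then have "(\<Sum>t\<in>V. walk2 G a t * adj G t z) = 1" if "z = a \<or> z = b" for z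
    using that fin v triangular by (simp add: sum_of_bool_eq_times adj_self)
  then show "walk3 G a a = 2" "walk3 G a b = 3"
    unfolding walk3_def[of G] sum_attach by (simp_all add: adj_attach(6-9) walk2_attach_new(2,3))
qed

abbreviation "s \<equiv> int (card (nbrs H p)) + int (card (nbrs H q))"

lemma sum_walk3_attach_new: "(\<Sum>x\<in>V. (walk3 G a x)\<^sup>2) = s + 29"
proof -
  \<comment> \<open>For \<open>x \<noteq> v\<close> the walk count is a sum of three numbers from 0
    and 1, so squaring adds only the mixed products. For \<open>x = v\<close> it is 5, and
    \<open>21\<close> completes the 4 contributed by \<open>p\<close> and \<open>q\<close> to
    25.\<close>
  have "(\<Sum>x\<in>V. (walk3 G a x)\<^sup>2) = (\<Sum>x\<in>V. adj H p x + adj H q x + 2 * (adj H p x * adj H x q)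
      + adj H v x + 2 * (adj H v x * adj H x p) + 2 * (adj H v x * adj H x q) + e x * 21)"
  proof (intro sum.cong refl)
    fix x assume x: "x \<in> V"
    have pv: "adj H p v = 1" "adj H q v = 1" "adj H v v = 0"
      using arcs triangular by (simp_all add: adj_self) (simp_all add: adj_def)
    have sym: "adj H x p = adj H p x" "adj H x q = adj H q x"
      using triangular by (simp_all add: adj_commute)
    have "walk3 G a x = adj H p x + adj H q x + adj H v x + 3 * e x"
      using x by (simp add: walk3_attach_new(1) walk2_v)
    then show "(walk3 G a x)\<^sup>2 = adj H p x + adj H q x + 2 * (adj H p x * adj H x q)
      + adj H v x + 2 * (adj H v x * adj H x p) + 2 * (adj H v x * adj H x q) + e x * 21"
      unfolding sym using pv by (cases "x = v") (auto simp: adj_def)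
  qed
  \<comment> \<open>The mixed products add up to numbers of walks of length two along the arcs of
    the triangle on \<open>v\<close>, \<open>p\<close>, \<open>q\<close>; each of them is 1.\<close>
  also have "\<dots> = s + 2 * walk2 H p q + 2 + 2 * walk2 H v p + 2 * walk2 H v q + 21"
    unfolding sum.distrib sum_distrib_left[symmetric] walk2_def[symmetric]
    using triangular fin v nbrs_v pq by (simp add: sum_adj sum_of_bool_eq_times)
  finally show ?thesis
    using triangular arcs by (simp add: walk2_arc)
qed

lemma sum_walk3_attach_old:
  "(\<Sum>x\<in>V. \<Sum>y\<in>V. (walk3 G x y)\<^sup>2) = closed6 H + 8 * s + 44"
proof -
  \<comment> \<open>For \<open>y \<noteq> v\<close> this is the increase of the squared entry in row
    \<open>v\<close>, namely \<open>(w + 2 * c)^2 - w^2\<close> with \<open>c * c = c\<close>. At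
    \<open>(v, v)\<close> it vanishes, and the growth of the entry from 2 to 4 is the separate
    summand 12.\<close>
  let ?f = "\<lambda>y. 4 * (walk3 H v y * adj H v y) + 4 * adj H v y"
  have f: "sum ?f V = 4 * s + 16"
  proof -
    have "(\<Sum>y\<in>V. walk3 H v y * adj H v y) = walk3 H v p + walk3 H v q"
      unfolding adj_v using fin pq_verts by (simp only: distrib_left sum.distrib sum_of_bool_eq_times)
    then show ?thesis
      unfolding sum.distrib sum_distrib_left[symmetric]
      using triangular nbrs_v pq by (simp add: sum_adj walk3_v_values)
  qed
  have pt: "(walk3 G x y)\<^sup>2 = (walk3 H x y)\<^sup>2 + e x * ?f y + e y * ?f x + e x * (e y * 12)"
    if "x \<in> V" "y \<in> V" for x y
  proof -
    have "adj H v v = 0" "adj H x v = adj H v x" "walk3 H x v = walk3 H v x"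
      using triangular by (simp_all add: adj_self adj_commute walk3_commute)
    moreover have "adj H v x = 0 \<or> adj H v x = 1" "adj H v y = 0 \<or> adj H v y = 1"
      by (simp_all add: adj_def)
    ultimately show ?thesis
      unfolding walk3_attach[OF that] using walk3_v_values(1)
      by (cases "x = v"; cases "y = v") (auto simp: power2_sum)
  qed
  have "(\<Sum>x\<in>V. \<Sum>y\<in>V. (walk3 G x y)\<^sup>2) =
    (\<Sum>x\<in>V. \<Sum>y\<in>V. (walk3 H x y)\<^sup>2 + e x * ?f y + e y * ?f x + e x * (e y * 12))"
    by (intro sum.cong refl pt)
  also have "\<dots> = closed6 H + sum ?f V + sum ?f V + 12"
  proof -
    have "(\<Sum>x\<in>V. \<Sum>y\<in>V. e x * ?f y) = sum ?f V"
      unfolding sum_distrib_left[symmetric] by (rule sum_of_bool_eq_times(1)[OF fin v])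
    moreover have "(\<Sum>x\<in>V. \<Sum>y\<in>V. e y * ?f x) = sum ?f V"
      by (intro sum.cong refl sum_of_bool_eq_times(1)[OF fin v])
    moreover have "(\<Sum>x\<in>V. \<Sum>y\<in>V. e x * (e y * 12)) = 12"
      unfolding sum_distrib_left[symmetric] sum_of_bool_eq_times(1)[OF fin v] by simp
    ultimately show ?thesis
      unfolding sum.distrib[of _ _ V] closed6_eq[OF triangular] by simp
  qed
  finally show ?thesis
    unfolding f by simp
qed

text \<open>The squared entries of the cube are summed in blocks: the old block contributes
  \<open>8 * s\<close>, and each of the four strips between a new vertex and the old ones
  contributes \<open>s\<close>.\<close>

lemma closed6_attach: "closed6 G = closed6 H + 186 + 12 * s"
proof -
  have b: "walk3 G b b = 2" "walk3 G b a = 3" "(\<Sum>x\<in>V. (walk3 G b x)\<^sup>2) = s + 29"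
    using attachment.walk3_attach_new(2,3)[OF swap] attachment.sum_walk3_attach_new[OF swap]
    by (simp_all add: attach_commute[of H v b a])
  have sums: "(\<Sum>x\<in>V. (walk3 G x a)\<^sup>2) = s + 29" "(\<Sum>x\<in>V. (walk3 G x b)\<^sup>2) = s + 29"
    unfolding walk3_commute[OF G, of _ a] walk3_commute[OF G, of _ b]
    by (rule sum_walk3_attach_new, rule b)
  have "closed6 G = (2\<^sup>2 + 3\<^sup>2 + (s + 29)) + (3\<^sup>2 + 2\<^sup>2 + (s + 29))
      + ((s + 29) + (s + 29) + (closed6 H + 8 * s + 44))"
    unfolding closed6_eq[OF G] sum_attach sum.distrib sums b walk3_attach_new(2,3)
      sum_walk3_attach_new sum_walk3_attach_old ..
  then show ?thesis
    by simp
qed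

end

section \<open>Chains of triangles\<close>

text \<open>Chains inside an arbitrary vertex type. Members of the family are shown equal to such a
  chain, not just isomorphic, so that a gluing merely extends the labelling
  \<open>g\<close>.\<close>

definition relabelled_chain :: "nat \<Rightarrow> (nat \<Rightarrow> 'a) \<Rightarrow> 'a pair_pre_digraph" where
  "relabelled_chain m g = \<lparr>pverts = g ` {..2 * m}, parcs = map_prod g g ` parcs (triangle_chain m)\<rparr>"

text \<open>The value of \<^const>\<open>closed6\<close> at a chain of \<open>m\<close> triangles: the increments are \<open>186 + 12 (2 + 2)\<close>
  for the second triangle and \<open>186 + 12 (4 + 2)\<close> afterwards.\<close>

definition chain_closed6 :: "nat \<Rightarrow> int" where
  "chain_closed6 m = (if m = 1 then 66 else 258 * int m - 216)"

definition saturated_triangle :: "'a pair_pre_digraph \<Rightarrow> 'a \<Rightarrow> 'a \<Rightarrow> 'a \<Rightarrow> bool" where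
  "saturated_triangle G x y z \<longleftrightarrow> (x, y) \<in> parcs G \<and> (y, z) \<in> parcs G \<and> (x, z) \<in> parcs G \<and>
     card (nbrs G x) = 4 \<and> card (nbrs G y) = 4 \<and> card (nbrs G z) = 4"

section \<open>Neighbourhoods and degrees in a chain\<close>

lemma pverts_triangle_chain: "pverts (triangle_chain m) = {..2 * m}"
  by (simp add: triangle_chain_def)

lemma mem_parcs_triangle_chain:
  "(i, j) \<in> parcs (triangle_chain m) \<longleftrightarrow> i \<noteq> j \<and> (\<exists>l<m. i \<in> block l \<and> j \<in> block l)"
  by (simp add: triangle_chain_def)

lemma parcs_triangle_chain_le:
  "(i, j) \<in> parcs (triangle_chain m) \<Longrightarrow> i \<le> 2 * m \<and> j \<le> 2 * m"
  by (auto simp: mem_parcs_triangle_chain block_def)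

lemma mem_parcs_relabelled_chain:
  assumes "inj_on g {..2 * m}" "i \<le> 2 * m" "j \<le> 2 * m"
  shows "(g i, g j) \<in> parcs (relabelled_chain m g) \<longleftrightarrow> (i, j) \<in> parcs (triangle_chain m)"
proof
  assume "(g i, g j) \<in> parcs (relabelled_chain m g)"
  then obtain i' j' where ij: "(i', j') \<in> parcs (triangle_chain m)" "g i = g i'" "g j = g j'"
    by (auto simp: relabelled_chain_def)
  then have "i = i'" "j = j'"
    using assms parcs_triangle_chain_le[OF ij(1)] by (auto dest: inj_onD)
  with ij show "(i, j) \<in> parcs (triangle_chain m)"
    by simp
qed (force simp: relabelled_chain_def)

lemma nbrs_relabelled_chain:
  assumes "inj_on g {..2 * m}" "i \<le> 2 * m"
  shows "nbrs (relabelled_chain m g) (g i) = g ` nbrs (triangle_chain m) i"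
proof -
  have "w \<in> g ` nbrs (triangle_chain m) i" if w: "(g i, w) \<in> parcs (relabelled_chain m g)" for w
  proof -
    from w obtain j where "w = g j" "j \<le> 2 * m"
      using parcs_triangle_chain_le by (fastforce simp: relabelled_chain_def)
    then show ?thesis
      using w mem_parcs_relabelled_chain[OF assms] by (auto simp: nbrs_def)
  qed
  then show ?thesis
    by (force simp: nbrs_def relabelled_chain_def)
qed

lemma card_nbrs_relabelled_chain:
  assumes "inj_on g {..2 * m}" "i \<le> 2 * m"
  shows "card (nbrs (relabelled_chain m g) (g i)) = card (nbrs (triangle_chain m) i)"
  unfolding nbrs_relabelled_chain[OF assms]
  using parcs_triangle_chain_le
  by (intro card_image inj_on_subset[OF assms(1)]) (auto simp: nbrs_def)

text \<open>An odd vertex belongs to a single block, whereas an inner even vertex is the joint of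
  two consecutive blocks.\<close>

lemma nbrs_triangle_chain_odd:
  "l < m \<Longrightarrow> nbrs (triangle_chain m) (2 * l + 1) = {2 * l, 2 * l + 2}"
proof (intro equalityI subsetI)
  fix w assume "l < m" "w \<in> nbrs (triangle_chain m) (2 * l + 1)"
  then obtain k where "2 * l + 1 \<in> block k" "w \<in> block k" "w \<noteq> 2 * l + 1"
    by (auto simp: nbrs_def mem_parcs_triangle_chain)
  moreover from this have "k = l"
    by (auto simp: block_def)
  ultimately show "w \<in> {2 * l, 2 * l + 2}"
    by (auto simp: block_def)
qed (auto simp: nbrs_def mem_parcs_triangle_chain block_def)

lemma nbrs_triangle_chain_even:
  "nbrs (triangle_chain m) (2 * l) =
     (if 0 < l \<and> l \<le> m then {2 * l - 2, 2 * l - 1} else {}) \<union> (if l < m then {2 * l + 1, 2 * l + 2} else {})"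
proof (intro equalityI subsetI)
  fix w assume "w \<in> nbrs (triangle_chain m) (2 * l)"
  then obtain k where k: "k < m" "2 * l \<in> block k" "w \<in> block k" "w \<noteq> 2 * l"
    by (auto simp: nbrs_def mem_parcs_triangle_chain)
  then consider "k = l" | "l = Suc k"
    by (fastforce simp: block_def)
  then show "w \<in> (if 0 < l \<and> l \<le> m then {2 * l - 2, 2 * l - 1} else {}) \<union> (if l < m then {2 * l + 1, 2 * l + 2} else {})"
    using k by cases (auto simp: block_def)
next
  fix w assume w: "w \<in> (if 0 < l \<and> l \<le> m then {2 * l - 2, 2 * l - 1} else {}) \<union> (if l < m then {2 * l + 1, 2 * l + 2} else {})"
  then consider "l < m" "w \<in> {2 * l + 1, 2 * l + 2}" | "0 < l" "l \<le> m" "w \<in> {2 * l - 2, 2 * l - 1}"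
    by (auto split: if_splits)
  then show "w \<in> nbrs (triangle_chain m) (2 * l)"
  proof cases
    case 1
    then show ?thesis
      by (auto simp: nbrs_def mem_parcs_triangle_chain block_def)
  next
    case 2
    then have "2 * l \<in> block (l - 1)" "w \<in> block (l - 1)" "l - 1 < m" "w \<noteq> 2 * l"
      by (auto simp: block_def)
    then show ?thesis
      unfolding nbrs_def mem_parcs_triangle_chain by blast
  qed
qed

lemma card_nbrs_triangle_chain:
  "l < m \<Longrightarrow> card (nbrs (triangle_chain m) (2 * l + 1)) = 2"
  "0 < l \<Longrightarrow> l < m \<Longrightarrow> card (nbrs (triangle_chain m) (2 * l)) = 4"
  "0 < m \<Longrightarrow> card (nbrs (triangle_chain m) 0) = 2"
proof -
  show "l < m \<Longrightarrow> card (nbrs (triangle_chain m) (2 * l + 1)) = 2"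
    unfolding nbrs_triangle_chain_odd by simp
  show "card (nbrs (triangle_chain m) (2 * l)) = 4" if l: "0 < l" "l < m"
  proof -
    \<comment> \<open>Writing \<open>l\<close> as a successor resolves the truncated differences
      \<open>2 * l - 2\<close> and \<open>2 * l - 1\<close>.\<close>
    obtain k where "l = Suc k"
      using l(1) gr0_implies_Suc by blast
    then show ?thesis
      unfolding nbrs_triangle_chain_even using l by simp
  qed
  show "0 < m \<Longrightarrow> card (nbrs (triangle_chain m) 0) = 2"
    using nbrs_triangle_chain_even[of m 0] by simp
qed

section \<open>Symmetries of a chain\<close>

lemma relabelled_chain_comp:
  assumes "\<tau> ` {..2 * m} = {..2 * m}"
    and "map_prod \<tau> \<tau> ` parcs (triangle_chain m) = parcs (triangle_chain m)"
  shows "relabelled_chain m (g \<circ> \<tau>) = relabelled_chain m g"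
proof -
  have "(g \<circ> \<tau>) ` {..2 * m} = g ` {..2 * m}"
    by (simp only: image_comp[symmetric] assms(1))
  moreover have "map_prod (g \<circ> \<tau>) (g \<circ> \<tau>) = map_prod g g \<circ> map_prod \<tau> \<tau>"
    by (simp add: fun_eq_iff)
  then have "map_prod (g \<circ> \<tau>) (g \<circ> \<tau>) ` parcs (triangle_chain m) = map_prod g g ` parcs (triangle_chain m)"
    by (simp only: image_comp[symmetric] assms(2))
  ultimately show ?thesis
    by (simp add: relabelled_chain_def)
qed

text \<open>If an involution keeps vertices of a common block in a common block, it maps arcs to
  arcs; applying it twice gives the reverse inclusion, so it is an automorphism.\<close>

lemma relabelled_chain_comp_involution:
  assumes inv: "\<And>i. i \<le> 2 * m \<Longrightarrow> \<tau> i \<le> 2 * m \<and> \<tau> (\<tau> i) = i"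
    and arc: "\<And>i j l. l < m \<Longrightarrow> i \<in> block l \<Longrightarrow> j \<in> block l \<Longrightarrow> \<exists>l'<m. \<tau> i \<in> block l' \<and> \<tau> j \<in> block l'"
    and g: "inj_on g {..2 * m}"
  shows "relabelled_chain m (g \<circ> \<tau>) = relabelled_chain m g" and "inj_on (g \<circ> \<tau>) {..2 * m}"
proof -
  have img: "\<tau> ` {..2 * m} = {..2 * m}"
    using inv by (auto simp: image_iff) (metis atMost_iff)
  have inj: "inj_on \<tau> {..2 * m}"
    by (rule inj_on_inverseI[of _ \<tau>]) (use inv in auto)
  show "inj_on (g \<circ> \<tau>) {..2 * m}"
    using comp_inj_on[OF inj] g img by simp
  have arc': "(\<tau> i, \<tau> j) \<in> parcs (triangle_chain m)" if "(i, j) \<in> parcs (triangle_chain m)" for i j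
    using that arc[of _ i j] parcs_triangle_chain_le[OF that] inv[of i] inv[of j]
    unfolding mem_parcs_triangle_chain by metis
  have "(i, j) \<in> map_prod \<tau> \<tau> ` parcs (triangle_chain m)" if "(i, j) \<in> parcs (triangle_chain m)" for i j
  proof (rule image_eqI[OF _ arc'[OF that]])
    show "(i, j) = map_prod \<tau> \<tau> (\<tau> i, \<tau> j)"
      using parcs_triangle_chain_le[OF that] inv[of i] inv[of j] by simp
  qed
  moreover have "e \<in> parcs (triangle_chain m)" if "e \<in> map_prod \<tau> \<tau> ` parcs (triangle_chain m)" for e
    using that arc' by force
  ultimately have "map_prod \<tau> \<tau> ` parcs (triangle_chain m) = parcs (triangle_chain m)"
    by (intro equalityI subrelI) blast+
  with img show "relabelled_chain m (g \<circ> \<tau>) = relabelled_chain m g"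
    by (rule relabelled_chain_comp)
qed

text \<open>The listed positions are the vertices of degree 2 in the end triangles. Reversal and the
  exchange of the last two vertices are automorphisms whose composites take each of them to the last
  position, where the chain can be prolonged.\<close>

lemma relabelled_chain_end:
  assumes g: "inj_on g {..2 * m}" and m: "m \<ge> 1" and i: "i \<in> {0, 1, 2 * m - 1, 2 * m}"
  obtains h where "inj_on h {..2 * m}" "relabelled_chain m h = relabelled_chain m g" "h (2 * m) = g i"
proof -
  define \<rho> where "\<rho> j = 2 * m - j" for j :: nat
  define \<sigma> where "\<sigma> = transpose (2 * m - 1) (2 * m)"
  have rho_block: "\<exists>l'<m. \<rho> i \<in> block l' \<and> \<rho> j \<in> block l'"
    if l: "l < m" "i \<in> block l" "j \<in> block l" for i j l
  proof -
    have "\<rho> i \<in> block (m - 1 - l)" "\<rho> j \<in> block (m - 1 - l)"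
      using l by (auto simp: block_def \<rho>_def)
    then show "\<exists>l'<m. \<rho> i \<in> block l' \<and> \<rho> j \<in> block l'"
      using l by (intro exI[of _ "m - 1 - l"]) auto
  qed
  have rho_inv: "\<rho> i \<le> 2 * m \<and> \<rho> (\<rho> i) = i" if "i \<le> 2 * m" for i
    using that by (auto simp: \<rho>_def)
  have rho: "relabelled_chain m (f \<circ> \<rho>) = relabelled_chain m f" "inj_on (f \<circ> \<rho>) {..2 * m}"
    if "inj_on f {..2 * m}" for f :: "nat \<Rightarrow> 'a"
    using relabelled_chain_comp_involution[of m \<rho> f] rho_inv rho_block that by blast+
  have sigma_block: "\<exists>l'<m. \<sigma> i \<in> block l' \<and> \<sigma> j \<in> block l'"
    if l: "l < m" "i \<in> block l" "j \<in> block l" for i j l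
  proof -
    have "\<sigma> x \<in> block l" if "x \<in> block l" for x
    \<comment> \<open>The two exchanged vertices both lie in the last block, and no other block
      contains either of them.\<close>
    proof (cases "Suc l = m")
      case True
      then show ?thesis
        using that by (auto simp: \<sigma>_def transpose_def block_def)
    next
      case False
      then have "x \<noteq> 2 * m - 1" "x \<noteq> 2 * m"
        using that l by (auto simp: block_def)
      then show ?thesis
        using that by (simp add: \<sigma>_def transpose_def)
    qed
    then show "\<exists>l'<m. \<sigma> i \<in> block l' \<and> \<sigma> j \<in> block l'"
      using l by blast
  qed
  have sigma_inv: "\<sigma> i \<le> 2 * m \<and> \<sigma> (\<sigma> i) = i" if "i \<le> 2 * m" for i
    using that by (auto simp: \<sigma>_def transpose_def)
  have sigma: "relabelled_chain m (f \<circ> \<sigma>) = relabelled_chain m f" "inj_on (f \<circ> \<sigma>) {..2 * m}"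
    if "inj_on f {..2 * m}" for f :: "nat \<Rightarrow> 'a"
    using relabelled_chain_comp_involution[of m \<sigma> f] sigma_inv sigma_block that by blast+
  consider "i = 2 * m" | "i = 0" | "i = 2 * m - 1" | "i = 1"
    using i by auto
  then show thesis
  proof cases
    case 1
    then show thesis using that[of g] g by simp
  next
    case 2
    then show thesis using that[of "g \<circ> \<rho>"] rho[OF g] by (simp add: \<rho>_def)
  next
    case 3
    then show thesis using that[of "g \<circ> \<sigma>"] sigma[OF g] by (simp add: \<sigma>_def)
  next
    case 4
    then show thesis using that[of "g \<circ> \<rho> \<circ> \<sigma>"] rho[OF g] sigma[of "g \<circ> \<rho>"] m
      by (simp add: \<sigma>_def \<rho>_def)
  qed
qed

section \<open>Prolonging a chain by one triangle\<close>

lemma parcs_triangle_chain_Suc: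
  "parcs (triangle_chain (Suc m)) = parcs (triangle_chain m) \<union>
     {(2 * m, 2 * m + 1), (2 * m + 1, 2 * m), (2 * m, 2 * m + 2), (2 * m + 2, 2 * m),
      (2 * m + 1, 2 * m + 2), (2 * m + 2, 2 * m + 1)}" (is "_ = _ \<union> ?N")
proof -
  have "block m = {2 * m, 2 * m + 1, 2 * m + 2}"
    by (auto simp: block_def)
  then have "(i, j) \<in> ?N \<longleftrightarrow> i \<noteq> j \<and> i \<in> block m \<and> j \<in> block m" for i j
    by auto
  then have "(i, j) \<in> parcs (triangle_chain (Suc m)) \<longleftrightarrow> (i, j) \<in> parcs (triangle_chain m) \<union> ?N" for i j
    unfolding Un_iff mem_parcs_triangle_chain less_Suc_eq by blast
  then show ?thesis
    by (intro equalityI subsetI; clarify) blast+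
qed

lemma attach_relabelled_chain:
  assumes g: "inj_on g {..2 * m}" and new: "a \<notin> g ` {..2 * m}" "b \<notin> g ` {..2 * m}" "a \<noteq> b"
  defines "h \<equiv> g(2 * m + 1 := a, 2 * m + 2 := b)"
  shows "inj_on h {..2 * Suc m}" "attach (relabelled_chain m g) (g (2 * m)) a b = relabelled_chain (Suc m) h"
proof -
  have ivl: "{..2 * Suc m} = insert (2 * m + 2) (insert (2 * m + 1) {..2 * m})"
    by auto
  have old: "h i = g i" if "i \<le> 2 * m" for i
    using that by (simp add: h_def)
  have h: "h (2 * m + 1) = a" "h (2 * m + 2) = b"
    by (simp_all add: h_def)
  have img: "h ` {..2 * m} = g ` {..2 * m}"
    using old by (intro image_cong) auto
  have "inj_on h {..2 * m}"
    using g old by (simp add: inj_on_def)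
  then show "inj_on h {..2 * Suc m}"
    unfolding ivl using img new h by (auto simp: inj_on_insert)
  have arcs: "map_prod h h ` parcs (triangle_chain m) = map_prod g g ` parcs (triangle_chain m)"
    by (intro image_cong refl) (auto simp: old dest: parcs_triangle_chain_le)
  show "attach (relabelled_chain m g) (g (2 * m)) a b = relabelled_chain (Suc m) h"
    unfolding attach_def relabelled_chain_def parcs_triangle_chain_Suc ivl image_Un arcs image_insert img h
    using h old[of "2 * m"] by (auto simp: image_Un arcs)
qed

section \<open>Isomorphism of chains of equal length\<close>

lemma wf_triangle_chain: "wf_digraph (with_proj (triangle_chain m))"
  by unfold_locales (auto simp: pverts_triangle_chain dest: parcs_triangle_chain_le)

lemma triangle_chain_iso_relabelled_chain:
  fixes f :: "nat \<Rightarrow> 'a"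
  assumes f: "inj_on f {..2 * m}"
  shows "digraph_iso (with_proj (triangle_chain m)) (with_proj (relabelled_chain m f))"
proof -
  define F :: "(nat, nat \<times> nat, 'a, 'a \<times> 'a) digraph_isomorphism" where
    "F = \<lparr>iso_verts = f, iso_arcs = map_prod f f, iso_head = snd, iso_tail = fst\<rparr>"
  have "inj_on (map_prod f f) (parcs (triangle_chain m))"
    by (rule inj_on_subset[OF map_prod_inj_on[OF f f]]) (auto dest: parcs_triangle_chain_le)
  then have "pre_digraph.digraph_isomorphism (with_proj (triangle_chain m)) F"
    using f wf_triangle_chain by (auto simp: pre_digraph.digraph_isomorphism_def F_def pverts_triangle_chain)
  moreover have "with_proj (relabelled_chain m f) = app_iso F (with_proj (triangle_chain m))"
    by (simp add: with_proj_def app_iso_def F_def relabelled_chain_def pverts_triangle_chain)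
  ultimately show ?thesis
    unfolding digraph_iso_def by blast
qed

text \<open>Both are compared with the fixed chain on the natural numbers, so their vertex types may
  differ.\<close>

lemma relabelled_chain_iso:
  assumes "inj_on g {..2 * m}" "inj_on h {..2 * m}"
  shows "digraph_iso (with_proj (relabelled_chain m g)) (with_proj (relabelled_chain m h))"
  by (rule digraph_iso_trans[OF digraph_iso_swap[OF wf_triangle_chain
        triangle_chain_iso_relabelled_chain[OF assms(1)]] triangle_chain_iso_relabelled_chain[OF assms(2)]])

section \<open>Saturated triangles\<close>

lemma closed6_triangle:
  assumes "distinct [x, y, z]"
  shows "closed6 \<lparr>pverts = {x, y, z}, parcs = {(x, y), (y, x), (x, z), (z, x), (y, z), (z, y)}\<rparr> = 66"
    (is "closed6 ?T = _")
proof -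
  have ne: "x \<noteq> y" "x \<noteq> z" "y \<noteq> z"
    using assms by auto
  have a: "adj ?T x x = 0" "adj ?T y y = 0" "adj ?T z z = 0" "adj ?T x y = 1" "adj ?T y x = 1"
    "adj ?T x z = 1" "adj ?T z x = 1" "adj ?T y z = 1" "adj ?T z y = 1"
    using ne ne[symmetric] by (simp_all add: adj_def)
  from ne have sum: "sum f (pverts ?T) = f x + f y + f z" for f :: "_ \<Rightarrow> int"
    by simp
  \<comment> \<open>The value agrees with the eigenvalues 2, -1, -1 of a triangle: 64 + 1 +
    1.\<close>
  show ?thesis
    unfolding closed6_def walk3_def walk2_def sum a by simp
qed

lemma triangle_eq_relabelled_chain:
  assumes "distinct [x, y, z]"
  shows "\<exists>g. inj_on g {..2 * 1} \<and>
    \<lparr>pverts = {x, y, z}, parcs = {(x, y), (y, x), (x, z), (z, x), (y, z), (z, y)}\<rparr> = relabelled_chain 1 g"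
proof -
  define g where "g i = (if i = 0 then x else if i = 1 then y else z)" for i :: nat
  have ivl: "{..2 * 1} = {0, 1, 2 :: nat}"
    by auto
  have arcs: "parcs (triangle_chain 1) = {(0, 1), (1, 0), (0, 2), (2, 0), (1, 2), (2, 1)}"
    using parcs_triangle_chain_Suc[of 0] by (simp add: triangle_chain_def numeral_2_eq_2)
  have "inj_on g {..2 * 1}"
    unfolding ivl using assms by (simp add: g_def)
  moreover have "\<lparr>pverts = {x, y, z}, parcs = {(x, y), (y, x), (x, z), (z, x), (y, z), (z, y)}\<rparr> = relabelled_chain 1 g"
    unfolding relabelled_chain_def ivl arcs by (auto simp: g_def)
  ultimately show ?thesis
    by blast
qed

text \<open>A gluing takes place at a vertex of degree 2, hence away from the corners of a saturated
  triangle, whose degrees stay 4.\<close>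

lemma saturated_triangle_attach:
  assumes "triangular H" "v \<in> pverts H" "a \<notin> pverts H" "b \<notin> pverts H" "a \<noteq> b"
    and "saturated_triangle H x y z" "card (nbrs H v) = 2"
  shows "saturated_triangle (attach H v a b) x y z"
proof -
  have s: "(x, y) \<in> parcs H" "(y, z) \<in> parcs H" "(x, z) \<in> parcs H"
    "card (nbrs H x) = 4" "card (nbrs H y) = 4" "card (nbrs H z) = 4"
    using assms(6) by (simp_all add: saturated_triangle_def)
  then have "x \<noteq> v" "y \<noteq> v" "z \<noteq> v"
    using assms(7) by auto
  moreover have "x \<in> pverts H" "y \<in> pverts H" "z \<in> pverts H"
    using s triangularD(2,3)[OF assms(1)] by blast+
  ultimately have "card (nbrs (attach H v a b) x) = 4" "card (nbrs (attach H v a b) y) = 4"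
    "card (nbrs (attach H v a b) z) = 4"
    using s by (simp_all add: card_nbrs_attach[OF assms(1-5)])
  then show ?thesis
    using s by (simp add: saturated_triangle_def attach_def)
qed

section \<open>The alternative between chains and saturated triangles\<close>

definition is_chain :: "nat \<Rightarrow> 'a pair_pre_digraph \<Rightarrow> bool" where
  "is_chain m G \<longleftrightarrow> (\<exists>g. inj_on g {..2 * m} \<and> G = relabelled_chain m g)"

text \<open>The vertices of degree 2 in a chain are those in the end triangles and the odd ones of
  inner triangles. The first kind prolongs the chain, the second saturates a triangle at the price
  of a larger trace.\<close>

lemma attach_chain:
  assumes H: "triangular H" and v: "v \<in> pverts H" "card (nbrs H v) = 2"
    and new: "a \<notin> pverts H" "b \<notin> pverts H" "a \<noteq> b"
    and m: "m \<ge> 1" and chain: "is_chain m H" and val: "closed6 H = chain_closed6 m"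
  shows "is_chain (Suc m) (attach H v a b) \<and> closed6 (attach H v a b) = chain_closed6 (Suc m) \<or>
    (\<exists>x y z. saturated_triangle (attach H v a b) x y z) \<and> closed6 (attach H v a b) > chain_closed6 (Suc m)"
proof -
  obtain g where g: "inj_on g {..2 * m}" and H_eq: "H = relabelled_chain m g"
    using chain by (auto simp: is_chain_def)
  obtain i where i: "i \<le> 2 * m" "v = g i"
    using v by (auto simp: H_eq relabelled_chain_def)
  show ?thesis
  proof (cases "i \<in> {0, 1, 2 * m - 1, 2 * m}")
    case True
    obtain h where h: "inj_on h {..2 * m}" "relabelled_chain m h = relabelled_chain m g" "h (2 * m) = g i"
      using relabelled_chain_end[OF g m True] .
    have H_h: "H = relabelled_chain m h" and v_h: "v = h (2 * m)"
      using h H_eq i by simp_all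
    have "a \<notin> h ` {..2 * m}" "b \<notin> h ` {..2 * m}"
      using new by (simp_all add: H_h relabelled_chain_def)
    then have "is_chain (Suc m) (attach H v a b)"
      using attach_relabelled_chain[OF h(1) _ _ new(3)] unfolding is_chain_def H_h v_h by blast
    moreover have "closed6 (attach H v a b) = chain_closed6 (Suc m)"
    proof -
      obtain k where k: "m = Suc k"
        using m by (cases m) auto
      \<comment> \<open>\<open>q\<close> is the odd vertex of the last triangle, and
        \<open>p\<close> joins it to the previous one; only for \<open>k = 0\<close> is
        \<open>p\<close> the start of the chain, of degree 2 instead of 4.\<close>
      define p q where "p = h (2 * k)" and "q = h (2 * k + 1)"
      have "nbrs (triangle_chain m) (2 * m) = {2 * k, 2 * k + 1}"
        unfolding nbrs_triangle_chain_even using k by auto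
      then have "nbrs H v = {p, q}"
        unfolding H_h v_h using nbrs_relabelled_chain[OF h(1), of "2 * m"] by (simp add: p_def q_def)
      moreover have "p \<noteq> q"
        using h(1) k by (auto simp: p_def q_def dest: inj_onD)
      ultimately interpret att: attachment H v p q a b
        using H v new by unfold_locales auto
      have "card (nbrs H q) = 2"
        unfolding H_h q_def
        using card_nbrs_relabelled_chain[OF h(1), of "2 * k + 1"] card_nbrs_triangle_chain(1)[of k m] k by simp
      moreover have "card (nbrs H p) = (if k = 0 then 2 else 4)"
        unfolding H_h p_def using card_nbrs_relabelled_chain[OF h(1), of "2 * k"] k
        by (simp add: card_nbrs_triangle_chain)
      ultimately show ?thesis
        using att.closed6_attach val k by (simp add: chain_closed6_def)
    qed
    ultimately show ?thesis
      by blast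
  next
    case False
    \<comment> \<open>An even position off the ends is a joint, which has degree 4 and admits no
      gluing.\<close>
    have "odd i"
    proof
      assume "even i"
      then obtain l where "i = 2 * l"
        by blast
      moreover from this have "0 < l" "l < m"
        using False i by auto
      ultimately show False
        using v(2) card_nbrs_relabelled_chain[OF g i(1)] card_nbrs_triangle_chain(2)[of l m]
        by (simp add: H_eq i)
    qed
    then obtain l where l: "i = 2 * l + 1"
      using oddE by blast
    \<comment> \<open>The triangle of \<open>v\<close> is an inner one, so its other two vertices
      are joints of degree 4.\<close>
    then have bounds: "0 < l" "Suc l < m"
      using False i(1) by auto
    define p q where "p = g (2 * l)" and "q = g (2 * Suc l)"
    have nbrs: "nbrs H v = {p, q}"
      using nbrs_relabelled_chain[OF g i(1)] nbrs_triangle_chain_odd[of l m] bounds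
      by (simp add: p_def q_def H_eq i(2) l)
    moreover have "p \<noteq> q"
      using g bounds by (auto simp: p_def q_def dest: inj_onD)
    ultimately interpret att: attachment H v p q a b
      using H v new by unfold_locales auto
    have card: "card (nbrs H p) = 4" "card (nbrs H q) = 4"
      unfolding H_eq p_def q_def
      using card_nbrs_relabelled_chain[OF g, of "2 * l"] card_nbrs_relabelled_chain[OF g, of "2 * Suc l"] bounds
        card_nbrs_triangle_chain(2)[of l m] card_nbrs_triangle_chain(2)[of "Suc l" m] by simp_all
    have "p \<noteq> v" "q \<noteq> v"
      using att.arcs triangularD(4)[OF H] by auto
    then have "card (nbrs (attach H v a b) v) = 4" "card (nbrs (attach H v a b) p) = 4"
      "card (nbrs (attach H v a b) q) = 4"
      using v(2) card att.pq_verts card_nbrs_attach[OF H v(1) new] by simp_all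
    moreover have "(v, p) \<in> parcs (attach H v a b)" "(v, q) \<in> parcs (attach H v a b)"
      "(p, q) \<in> parcs (attach H v a b)"
      using att.arcs by (simp_all add: attach_def)
    ultimately have "saturated_triangle (attach H v a b) v p q"
      by (simp add: saturated_triangle_def)
    \<comment> \<open>Here \<open>closed6\<close> grows by 282, the chain value only by 258; an
      inner triangle forces \<open>m >= 3\<close>, so the exceptional value for \<open>m = 1\<close>
      does not occur.\<close>
    moreover have "closed6 (attach H v a b) > chain_closed6 (Suc m)"
      using att.closed6_attach val card bounds by (simp add: chain_closed6_def)
    ultimately show ?thesis
      by blast
  qed
qed

text \<open>The dichotomy carried through the induction. The clause \<open>m >= 2\<close> gives
  access to the linear branch of \<open>chain_closed6\<close> and to the neighbours of degree
  4.\<close>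

definition chain_alternative :: "nat \<Rightarrow> 'a pair_pre_digraph \<Rightarrow> bool" where
  "chain_alternative m G \<longleftrightarrow> is_chain m G \<and> closed6 G = chain_closed6 m \<or>
     m \<ge> 2 \<and> (\<exists>x y z. saturated_triangle G x y z) \<and> closed6 G > chain_closed6 m"

text \<open>The invariants are proved together because the one on degrees and the one on neighbours
  of degree 4 bound the next increase from below. Here \<open>m\<close> is the number of
  triangles.\<close>

lemma triangle_family_invariants:
  assumes "G \<in> triangle_family"
  shows "triangular G \<and> (\<forall>x\<in>pverts G. card (nbrs G x) \<in> {2, 4}) \<and>
    (\<exists>m\<ge>1. card (pverts G) = 2 * m + 1 \<and> chain_alternative m G \<and>
      (m \<ge> 2 \<longrightarrow> (\<forall>x\<in>pverts G. card (nbrs G x) = 2 \<longrightarrow> (\<exists>y. (x, y) \<in> parcs G \<and> card (nbrs G y) = 4))))"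
  using assms
proof (induction rule: triangle_family_induct)
  case (triangle x y z)
  let ?T = "\<lparr>pverts = {x, y, z}, parcs = {(x, y), (y, x), (x, z), (z, x), (y, z), (z, y)}\<rparr>"
  have "nbrs ?T x = {y, z}" "nbrs ?T y = {x, z}" "nbrs ?T z = {x, y}"
    using triangle by (auto simp: nbrs_def)
  then have "\<forall>w\<in>pverts ?T. card (nbrs ?T w) \<in> {2, 4}"
    using triangle by auto
  moreover have "chain_alternative 1 ?T"
    using triangle_eq_relabelled_chain[OF triangle] closed6_triangle[OF triangle]
    by (auto simp: chain_alternative_def is_chain_def chain_closed6_def)
  moreover have "card (pverts ?T) = 2 * 1 + 1"
    using triangle by simp
  ultimately show ?case
    using triangular_triangle[OF triangle] by (intro conjI exI[of _ 1]) auto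
next
  case (attach H v a b)
  let ?G = "attach H v a b"
  have H: "triangular H" and deg: "\<And>x. x \<in> pverts H \<Longrightarrow> card (nbrs H x) \<in> {2, 4}"
    using attach.IH by auto
  obtain m where m: "m \<ge> 1" "card (pverts H) = 2 * m + 1" "chain_alternative m H"
    and leaf: "\<And>x. m \<ge> 2 \<Longrightarrow> x \<in> pverts H \<Longrightarrow> card (nbrs H x) = 2 \<Longrightarrow>
      \<exists>y. (x, y) \<in> parcs H \<and> card (nbrs H y) = 4"
    using attach.IH by blast
  note v = attach.hyps(2,3) and new = attach.hyps(4-6)
  note card_attach = card_nbrs_attach[OF H v(1) new]
  have verts: "pverts ?G = insert a (insert b (pverts H))"
    by (simp add: attach_def)
  have "card (nbrs ?G x) \<in> {2, 4}" if "x \<in> pverts ?G" for x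
    using that deg[of x] v card_attach unfolding verts by (cases "x = v") auto
  moreover have "card (pverts ?G) = 2 * Suc m + 1"
    using triangularD(1)[OF H] new m(2) by (simp add: verts)
  moreover have "chain_alternative (Suc m) ?G"
  proof (cases "is_chain m H \<and> closed6 H = chain_closed6 m")
    case True
    then show ?thesis
      using attach_chain[OF H v new m(1)] m(1) by (auto simp: chain_alternative_def)
  next
    case False
    then obtain x y z where m2: "m \<ge> 2" and sat: "saturated_triangle H x y z" and gt: "closed6 H > chain_closed6 m"
      using m(3) by (auto simp: chain_alternative_def)
    obtain p q where pq: "nbrs H v = {p, q}" "p \<noteq> q"
      using v(2) by (auto simp: card_2_iff)
    interpret att: attachment H v p q a b
      using H v new pq by unfold_locales auto
    obtain y where "(v, y) \<in> parcs H" "card (nbrs H y) = 4"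
      using leaf[OF m2 v] by blast
    moreover from this have "y \<in> {p, q}"
      by (simp add: nbrs_def flip: pq(1))
    \<comment> \<open>One neighbour of \<open>v\<close> has degree 4 and the other at least 2. So
      \<open>closed6\<close> grows by at least 258, as much as the chain value, and the strict
      excess persists.\<close>
    ultimately have "att.s \<ge> 6"
      using deg[OF att.pq_verts(1)] deg[OF att.pq_verts(2)] by auto
    then have "closed6 ?G > chain_closed6 (Suc m)"
      using att.closed6_attach gt m2 by (simp add: chain_closed6_def)
    moreover have "saturated_triangle ?G x y z" if "saturated_triangle H x y z" for x y z
      using saturated_triangle_attach[OF H v(1) new that v(2)] .
    ultimately show ?thesis
      using sat m2 unfolding chain_alternative_def by (metis le_SucI)
  qed
  moreover have "\<exists>y. (x, y) \<in> parcs ?G \<and> card (nbrs ?G y) = 4"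
    if x: "x \<in> pverts ?G" "card (nbrs ?G x) = 2" for x
  proof -
    have v4: "card (nbrs ?G v) = 4"
      using card_attach(2) v by simp
    then have "x \<noteq> v"
      using x by auto
    \<comment> \<open>A new vertex is adjacent to \<open>v\<close>, which now has degree 4. An old
      vertex keeps its neighbour of degree 4, which differs from \<open>v\<close> since
      \<open>v\<close> had degree 2.\<close>
    consider "x = a \<or> x = b" | "x \<in> pverts H" "m \<ge> 2" | "x \<in> pverts H" "m = 1"
      using x m(1) verts by force
    then show ?thesis
    proof cases
      case 1
      then show ?thesis
        using v4 by (auto simp: attach_def)
    next
      case 2
      then obtain y where y: "(x, y) \<in> parcs H" "card (nbrs H y) = 4"
        using leaf[of x] x card_attach(1)[of x] \<open>x \<noteq> v\<close> by auto
      moreover from this have "y \<noteq> v" "y \<in> pverts H"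
        using v triangularD(3)[OF H] by auto
      ultimately show ?thesis
        using card_attach(1)[of y] by (auto simp: attach_def)
    next
      case 3
      \<comment> \<open>Only three vertices: the two neighbours of \<open>v\<close> exhaust the others.\<close>
      have "nbrs H v \<subseteq> pverts H - {v}"
        using triangularD(3,4)[OF H] by (auto simp: nbrs_def)
      moreover have "card (pverts H - {v}) = card (nbrs H v)"
        using 3 m(2) v by simp
      ultimately have "nbrs H v = pverts H - {v}"
        using triangularD(1)[OF H] by (intro card_subset_eq) auto
      then have "(v, x) \<in> parcs H"
        using 3 \<open>x \<noteq> v\<close> by (auto simp: nbrs_def)
      then have "(x, v) \<in> parcs ?G"
        using triangularD(5)[OF H] by (auto simp: attach_def)
      then show ?thesis
        using v4 by blast
    qed
  qed
  ultimately show ?case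
    using triangular_attach[OF H v(1) new] by (intro conjI exI[of _ "Suc m"]) auto
qed

section \<open>Triangles as vertices of the clique graph\<close>

lemma triangle_in_max_cliques:
  assumes G: "triangular G" and xyz: "(x, y) \<in> parcs G" "(y, z) \<in> parcs G" "(x, z) \<in> parcs G"
  shows "{x, y, z} \<in> max_cliques G"
proof -
  have "is_clique G {x, y, z}"
    using xyz triangularD(2,3,5)[OF G] unfolding is_clique_def by blast
  moreover have "R = {x, y, z}" if R: "is_clique G R" "{x, y, z} \<subseteq> R" for R
  proof -
    have "r \<in> {x, y, z}" if "r \<in> R" for r
    proof (rule ccontr)
      assume "r \<notin> {x, y, z}"
      \<comment> \<open>Then \<open>r\<close> is a second common neighbour of \<open>x\<close> and
        \<open>y\<close> besides \<open>z\<close>.\<close>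
      then have "(x, r) \<in> parcs G" "(y, r) \<in> parcs G"
        using R that unfolding is_clique_def by auto
      then show False
        using triangularD(7)[OF G xyz(1,3,2)] \<open>r \<notin> {x, y, z}\<close> by blast
    qed
    then show ?thesis
      using R(2) by blast
  qed
  ultimately show ?thesis
    unfolding max_cliques_def by blast
qed

text \<open>Of the four neighbours of \<open>x\<close> only two belong to the given triangle; an arc
  from \<open>x\<close> to another one lies in a further triangle.\<close>

lemma other_triangle_at_saturated_vertex:
  assumes G: "triangular G" and xyz: "(x, y) \<in> parcs G" "(y, z) \<in> parcs G" "(x, z) \<in> parcs G"
    and x: "card (nbrs G x) = 4"
  shows "\<exists>Q\<in>max_cliques G. Q \<inter> {x, y, z} = {x} \<and> Q \<noteq> {x, y, z}"
proof -
  note D = triangularD[OF G]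
  have "\<not> nbrs G x \<subseteq> {y, z}"
    using card_mono[of "{y, z}" "nbrs G x"] card_insert_le_m1[of 2 "{z}" y] x by (auto simp: card_insert_if split: if_splits)
  then obtain w where w: "(x, w) \<in> parcs G" "w \<noteq> y" "w \<noteq> z"
    by (auto simp: nbrs_def)
  obtain t where t: "(x, t) \<in> parcs G" "(w, t) \<in> parcs G"
    using D(6)[OF w(1)] by blast
  \<comment> \<open>If \<open>t\<close> were \<open>y\<close> or \<open>z\<close>, the arc from
    \<open>x\<close> to \<open>t\<close> would have \<open>w\<close> as a second common neighbour of
    its ends.\<close>
  have "t \<noteq> y" "t \<noteq> z"
    using D(7)[OF xyz(1,3,2), of w] D(7)[OF xyz(3,1) D(5)[OF xyz(2)], of w] w t D(5)[OF t(2)] by auto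
  moreover have "w \<noteq> x" "x \<noteq> y" "x \<noteq> z"
    using w xyz D(4) by auto
  ultimately have "{x, w, t} \<inter> {x, y, z} = {x} \<and> {x, w, t} \<noteq> {x, y, z}"
    using w by auto
  then show ?thesis
    using triangle_in_max_cliques[OF G w(1) t(2,1)] by blast
qed

text \<open>The further cliques at the three corners are distinct because they meet \<open>Q\<close>
  in different vertices. Hence \<open>Q\<close> has degree at least 3 in the clique graph, while
  degrees in a path are at most 2.\<close>

lemma path_clique_graph_not_saturated:
  assumes G: "triangular G" and sat: "saturated_triangle G x y z"
    and iso: "digraph_iso (with_proj (clique_graph G)) (with_proj (path_graph k))"
  shows False
proof -
  note D = triangularD[OF G]
  have xyz: "(x, y) \<in> parcs G" "(y, z) \<in> parcs G" "(x, z) \<in> parcs G"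
    and card: "card (nbrs G x) = 4" "card (nbrs G y) = 4" "card (nbrs G z) = 4"
    using sat by (auto simp: saturated_triangle_def)
  note yx = D(5)[OF xyz(1)] D(5)[OF xyz(2)] D(5)[OF xyz(3)]
  have ne: "x \<noteq> y" "y \<noteq> z" "x \<noteq> z"
    using xyz D(4) by auto
  define Q where "Q = {x, y, z}"
  have Q: "Q \<in> max_cliques G"
    unfolding Q_def by (rule triangle_in_max_cliques[OF G xyz])
  have perm: "{y, x, z} = Q" "{z, x, y} = Q"
    by (auto simp: Q_def)
  obtain Qx where Qx: "Qx \<in> max_cliques G" "Qx \<inter> Q = {x}" "Qx \<noteq> Q"
    using other_triangle_at_saturated_vertex[OF G xyz card(1)] unfolding Q_def by blast
  obtain Qy where Qy: "Qy \<in> max_cliques G" "Qy \<inter> Q = {y}" "Qy \<noteq> Q"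
    using other_triangle_at_saturated_vertex[OF G yx(1) xyz(3,2) card(2)] unfolding perm by blast
  obtain Qz where Qz: "Qz \<in> max_cliques G" "Qz \<inter> Q = {z}" "Qz \<noteq> Q"
    using other_triangle_at_saturated_vertex[OF G yx(3) xyz(1) yx(2) card(3)] unfolding perm by blast
  have sub: "{(Q, Qx), (Q, Qy), (Q, Qz)} \<subseteq> out_arcs (with_proj (clique_graph G)) Q"
    using Q Qx Qy Qz by (auto simp: out_arcs_def clique_graph_def)
  have "Qx \<noteq> Qy" "Qy \<noteq> Qz" "Qx \<noteq> Qz"
    using Qx Qy Qz ne by auto
  then have three: "card {(Q, Qx), (Q, Qy), (Q, Qz)} = 3"
    by simp
  obtain f where f: "pre_digraph.digraph_isomorphism (with_proj (clique_graph G)) f"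
    and path: "with_proj (path_graph k) = app_iso f (with_proj (clique_graph G))"
    using iso unfolding digraph_iso_def by blast
  have QV: "Q \<in> verts (with_proj (clique_graph G))"
    using Q by (simp add: clique_graph_def)
  define i where "i = iso_verts f Q"
  have "wf_digraph (with_proj (clique_graph G))"
    by unfold_locales (auto simp: clique_graph_def)
  then have eq: "out_degree (with_proj (path_graph k)) i = out_degree (with_proj (clique_graph G)) Q"
    unfolding path i_def by (rule wf_digraph.out_degree_app_iso_eq[OF _ f QV])
  have "max_cliques G \<subseteq> Pow (pverts G)"
    by (auto simp: max_cliques_def is_clique_def)
  then have "finite (max_cliques G \<times> max_cliques G)"
    using D(1) by (simp add: finite_subset)
  then have fin: "finite (out_arcs (with_proj (clique_graph G)) Q)"
    by (rule rev_finite_subset) (auto simp: out_arcs_def clique_graph_def)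
  \<comment> \<open>For \<open>i = 0\<close> the truncated \<open>i - 1\<close> just puts
    \<open>(0, 0)\<close> into the upper bound.\<close>
  have "out_arcs (with_proj (path_graph k)) i \<subseteq> {(i, Suc i), (i, i - 1)}"
    by (auto simp: out_arcs_def path_graph_def)
  then have "out_degree (with_proj (path_graph k)) i \<le> card {(i, Suc i), (i, i - 1)}"
    unfolding out_degree_def by (intro card_mono) auto
  also have "\<dots> \<le> 2"
    by (simp add: card_insert_if)
  also have "2 < card {(Q, Qx), (Q, Qy), (Q, Qz)}"
    using three by simp
  also have "\<dots> \<le> out_degree (with_proj (clique_graph G)) Q"
    unfolding out_degree_def by (rule card_mono[OF fin sub])
  finally show False
    using eq by simp
qed

section \<open>From the spectrum to the isomorphism\<close>

theorem theorem4:
  fixes G :: "'a pair_pre_digraph" and H :: "'b pair_pre_digraph" and k :: nat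
  assumes "k \<ge> 1"
    and "H \<in> triangle_family"
    and "digraph_iso (with_proj (clique_graph H)) (with_proj (path_graph k))"
    and "G \<in> triangle_family"
    and "adj_spectrum G = adj_spectrum H"
  shows "digraph_iso (with_proj G) (with_proj H)"
proof -
  obtain m where H: "triangular H" "card (pverts H) = 2 * m + 1" "chain_alternative m H"
    using triangle_family_invariants[OF assms(2)] by blast
  obtain n where G: "triangular G" "card (pverts G) = 2 * n + 1" "chain_alternative n G"
    using triangle_family_invariants[OF assms(4)] by blast
  have fin: "finite (pverts G)" "finite (pverts H)"
    using G(1) H(1) by (simp_all add: triangular_def)
  \<comment> \<open>The size of the spectrum is the number of vertices, so both graphs have equally
    many triangles.\<close>
  have mn: "n = m"
    using size_adj_spectrum[OF fin(1)] size_adj_spectrum[OF fin(2)] assms(5) G(2) H(2) by simp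
  have "complex_of_int (closed6 G) = complex_of_int (closed6 H)"
    using closed6_eq_sum_adj_spectrum[OF fin(1)] closed6_eq_sum_adj_spectrum[OF fin(2)] assms(5) by simp
  then have "closed6 G = closed6 H"
    by simp
  \<comment> \<open>The path rules out a saturated triangle in \<open>H\<close>, so
    \<open>closed6 H\<close> is the chain value. \<open>G\<close> has the same value, which its own
    saturated alternative would exceed.\<close>
  moreover have "is_chain m H" "closed6 H = chain_closed6 m"
    using H(3) path_clique_graph_not_saturated[OF H(1) _ assms(3)] by (auto simp: chain_alternative_def)
  ultimately have "is_chain m G" "is_chain m H"
    using G(3) mn by (auto simp: chain_alternative_def)
  then show ?thesis
    using relabelled_chain_iso by (auto simp: is_chain_def)
qed

end
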